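(* Let $X$ be a compact metric space and $f\colon X\to X$ a continuous map with the shadowing property. If $\dim X=0$ and $h_{top}(f)>0$, then there exist a Mycielski subset $S$ of $X$ and numbers $\delta_n>0$ ($n\ge2$) such that $S$ is distributionally $n$-$\delta_n$-scrambled for all $n\ge2$.
   Context: $(X,d)$ is a compact metric space, $h_{top}$ denotes topological entropy. For $\delta>0$, a sequence $(x_i)_{i\ge0}$ in $X$ is a $\delta$-pseudo orbit of $f$ if $d(f(x_i),x_{i+1})\le\delta$ for all $i\ge0$; it is $\epsilon$-shadowed by $x\in X$ if $d(f^i(x),x_i)\le\epsilon$ for all $i\ge0$. $f$ has the shadowing property if for every $\epsilon>0$ there is $\delta>0$ such that every $\delta$-pseudo orbit of $f$ is $\epsilon$-shadowed by some point of $X$. A Mycielski set is a countable union of Cantor sets. For $n\ge2$ and $\delta>0$, an $n$-tuple $(x_1,\dots,x_n)\in X^n$ is distributionally $n$-$\delta$-scrambled if for every $\epsilon>0$, $\limsup_{m\to\infty}\frac1m|\{0\le k\le m-1:\max_{1\le i<j\le n}d(f^k(x_i),f^k(x_j))<\epsilon\}|=1$, and $\limsup_{m\to\infty}\frac1m|\{0\le k\le m-1:\min_{1\le i<j\le n}d(f^k(x_i),f^k(x_j))>\delta\}|=1$. A set $S\subset X$ is distributionally $n$-$\delta$-scrambled if every $n$-tuple of distinct points of $S$ is distributionally $n$-$\delta$-scrambled. *)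

theory Defs
  imports "HOL-Analysis.Analysis" "HOL-Library.Liminf_Limsup"
begin

definition shadowing :: "'a::metric_space set \<Rightarrow> ('a \<Rightarrow> 'a) \<Rightarrow> bool" where
  "shadowing X f \<longleftrightarrow>
     (\<forall>\<epsilon>>0. \<exists>\<delta>>0. \<forall>xs::nat \<Rightarrow> 'a.
        (\<forall>i. xs i \<in> X) \<and> (\<forall>i. dist (f (xs i)) (xs (Suc i)) \<le> \<delta>)
        \<longrightarrow> (\<exists>x\<in>X. \<forall>i. dist ((f ^^ i) x) (xs i) \<le> \<epsilon>))"

definition separated_set :: "'a::metric_space set \<Rightarrow> ('a \<Rightarrow> 'a) \<Rightarrow> nat \<Rightarrow> real \<Rightarrow> 'a set \<Rightarrow> bool" where
  "separated_set X f n \<epsilon> E \<longleftrightarrow> E \<subseteq> X \<and>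
     (\<forall>x\<in>E. \<forall>y\<in>E. x \<noteq> y \<longrightarrow> (\<exists>k<n. dist ((f ^^ k) x) ((f ^^ k) y) > \<epsilon>))"

definition max_separated :: "'a::metric_space set \<Rightarrow> ('a \<Rightarrow> 'a) \<Rightarrow> nat \<Rightarrow> real \<Rightarrow> real" where
  "max_separated X f n \<epsilon> = Sup {real (card E) | E. finite E \<and> separated_set X f n \<epsilon> E}"

definition entropy_at_scale :: "'a::metric_space set \<Rightarrow> ('a \<Rightarrow> 'a) \<Rightarrow> real \<Rightarrow> ereal" where
  "entropy_at_scale X f \<epsilon> = limsup (\<lambda>n. ereal (ln (max_separated X f n \<epsilon>) / real n))"

definition htop :: "'a::metric_space set \<Rightarrow> ('a \<Rightarrow> 'a) \<Rightarrow> ereal" where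
  "htop X f = (SUP \<epsilon>\<in>{0<..}. entropy_at_scale X f \<epsilon>)"

definition zero_dimensional :: "'a::metric_space set \<Rightarrow> bool" where
  "zero_dimensional X \<longleftrightarrow> X \<noteq> {} \<and>
     (\<forall>x\<in>X. \<forall>U. openin (top_of_set X) U \<and> x \<in> U \<longrightarrow>
        (\<exists>V. openin (top_of_set X) V \<and> closedin (top_of_set X) V \<and> x \<in> V \<and> V \<subseteq> U))"

definition cantor_ternary :: "real set" where
  "cantor_ternary = {x. \<exists>a::nat \<Rightarrow> nat. (\<forall>n. a n \<in> {0, 2}) \<and> x = (\<Sum>n. real (a n) / 3 ^ Suc n)}"

definition cantor_set :: "'a::metric_space set \<Rightarrow> bool" where
  "cantor_set C \<longleftrightarrow> C homeomorphic cantor_ternary"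

definition mycielski :: "'a::metric_space set \<Rightarrow> bool" where
  "mycielski S \<longleftrightarrow> (\<exists>C::nat \<Rightarrow> 'a set. (\<forall>i. cantor_set (C i)) \<and> S = (\<Union>i. C i))"

definition upper_density_one :: "(nat \<Rightarrow> bool) \<Rightarrow> bool" where
  "upper_density_one P \<longleftrightarrow>
     limsup (\<lambda>m. ereal (real (card {k. k < m \<and> P k}) / real m)) = 1"

definition dist_scrambled_tuple ::
  "('a::metric_space \<Rightarrow> 'a) \<Rightarrow> nat \<Rightarrow> real \<Rightarrow> (nat \<Rightarrow> 'a) \<Rightarrow> bool" where
  "dist_scrambled_tuple f n \<delta> xs \<longleftrightarrow>
     (\<forall>\<epsilon>>0. upper_density_one
        (\<lambda>k. \<forall>i j. i < j \<and> j < n \<longrightarrow> dist ((f ^^ k) (xs i)) ((f ^^ k) (xs j)) < \<epsilon>)) \<and>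
     upper_density_one
        (\<lambda>k. \<forall>i j. i < j \<and> j < n \<longrightarrow> dist ((f ^^ k) (xs i)) ((f ^^ k) (xs j)) > \<delta>)"

definition dist_scrambled_set ::
  "('a::metric_space \<Rightarrow> 'a) \<Rightarrow> nat \<Rightarrow> real \<Rightarrow> 'a set \<Rightarrow> bool" where
  "dist_scrambled_set f n \<delta> S \<longleftrightarrow>
     (\<forall>xs. (\<forall>i<n. xs i \<in> S) \<and> inj_on xs {..<n} \<longrightarrow> dist_scrambled_tuple f n \<delta> xs)"

end

(*
A pseudo-orbit construction. Positive entropy yields, at one fixed scale, two delta-cycles a, b of
equal length through a common point, for every delta: otherwise an orbit segment would be determined
up to that scale by the first and last visits to the cells of a finite cover, and separated sets
would grow only polynomially. The periodic concatenations y_0, y_1, ... of a and b are pairwise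
separated within bounded time windows.

The heart of the proof is a lifting step. Countably many delta-pseudo-orbits through a
base point, each of which can always be continued back to that base point, are packed into one
pseudo-orbit containing all their initial pieces at highly divisible times; a shadowing point x of it
returns near a limit point u' along times divisible by everything. Orbit segments of x between such
visits give new pseudo-orbits through u', with jumps as small as desired, that follow the old ones
after a time shift.

Points x_c, c a binary sequence, are obtained by iterating this. At stage k the histories for the
words of length k are extended, first by a long phase in which the word c follows y_i with i its
current label, then by a long phase common to all words, and the result is lifted to a smaller jump
size. In the first kind of phase differently labelled points stay apart (uniform continuity spreads
the separation over a window); in the second kind all points are close.
*)

theory Submission
  imports Defs "HOL-Real_Asymp.Real_Asymp"
begin

section \<open>Infinite pseudo-orbits and cycles\<close>

definition pseudo_orbit :: "'a::metric_space set \<Rightarrow> ('a \<Rightarrow> 'a) \<Rightarrow> real \<Rightarrow> (nat \<Rightarrow> 'a) \<Rightarrow> bool" where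
  "pseudo_orbit X f \<delta> \<xi> \<longleftrightarrow> (\<forall>t. \<xi> t \<in> X) \<and> (\<forall>t. dist (f (\<xi> t)) (\<xi> (Suc t)) \<le> \<delta>)"

definition switch_at :: "(nat \<Rightarrow> 'a) \<Rightarrow> nat \<Rightarrow> (nat \<Rightarrow> 'a) \<Rightarrow> nat \<Rightarrow> 'a" where
  "switch_at \<zeta> T \<xi> = (\<lambda>t. if t < T then \<zeta> t else \<xi> (t - T))"

lemma switch_at_before: "t < T \<Longrightarrow> switch_at \<zeta> T \<xi> t = \<zeta> t"
  and switch_at_after [simp]: "switch_at \<zeta> T \<xi> (T + t) = \<xi> t"
  and switch_at_at [simp]: "switch_at \<zeta> T \<xi> T = \<xi> 0"
  by (auto simp: switch_at_def)

lemma switch_at_upto: "\<zeta> T = \<xi> 0 \<Longrightarrow> t \<le> T \<Longrightarrow> switch_at \<zeta> T \<xi> t = \<zeta> t"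
  by (cases "t = T") (auto simp: switch_at_def)

lemma pseudo_orbit_jump:
  assumes "pseudo_orbit X f \<delta> \<zeta>" "pseudo_orbit X f \<delta> \<xi>"
    and "T > 0 \<Longrightarrow> dist (f (\<zeta> (T - 1))) (\<xi> 0) \<le> \<delta>"
  shows "pseudo_orbit X f \<delta> (switch_at \<zeta> T \<xi>)"
proof -
  have "dist (f (switch_at \<zeta> T \<xi> t)) (switch_at \<zeta> T \<xi> (Suc t)) \<le> \<delta>" for t
  proof -
    consider "Suc t < T" | "Suc t = T" | "t \<ge> T" by linarith
    then show ?thesis
    proof cases
      case 2
      then show ?thesis using assms(3) by (auto simp: switch_at_def)
    next
      case 3
      then show ?thesis using assms(2) by (auto simp: switch_at_def pseudo_orbit_def Suc_diff_le)
    qed (use assms(1) in \<open>auto simp: switch_at_def pseudo_orbit_def\<close>)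
  qed
  with assms(1,2) show ?thesis by (auto simp: pseudo_orbit_def switch_at_def)
qed

lemma pseudo_orbit_switch_at:
  assumes "pseudo_orbit X f \<delta> \<zeta>" "pseudo_orbit X f \<delta> \<xi>" "\<zeta> T = \<xi> 0"
  shows "pseudo_orbit X f \<delta> (switch_at \<zeta> T \<xi>)"
proof (rule pseudo_orbit_jump[OF assms(1,2)])
  assume "T > 0"
  then obtain T' where "T = Suc T'" using gr0_conv_Suc by blast
  with assms(1,3) show "dist (f (\<zeta> (T - 1))) (\<xi> 0) \<le> \<delta>"
    by (metis diff_Suc_1 pseudo_orbit_def)
qed

text \<open>Cycles are carried by infinite sequences, so that \<open>switch_at\<close> glues them
  without finite paths. \<open>T = 0\<close> is allowed and serves as the empty cycle.\<close>

definition cycle_at :: "'a::metric_space set \<Rightarrow> ('a \<Rightarrow> 'a) \<Rightarrow> real \<Rightarrow> 'a \<Rightarrow> nat \<Rightarrow> (nat \<Rightarrow> 'a) \<Rightarrow> bool" where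
  "cycle_at X f \<delta> u T \<zeta> \<longleftrightarrow> pseudo_orbit X f \<delta> \<zeta> \<and> \<zeta> 0 = u \<and> \<zeta> T = u"

text \<open>Return times divisible by \<open>N\<close> are what allows returns of different pseudo-orbits to be
  synchronised by inserting cycles of length \<open>N\<close>.\<close>

definition returning ::
  "'a::metric_space set \<Rightarrow> ('a \<Rightarrow> 'a) \<Rightarrow> real \<Rightarrow> 'a \<Rightarrow> nat \<Rightarrow> (nat \<Rightarrow> 'a) \<Rightarrow> bool" where
  "returning X f \<delta> u N \<xi> \<longleftrightarrow> pseudo_orbit X f \<delta> \<xi> \<and> \<xi> 0 = u \<and>
     (\<forall>t. \<exists>\<zeta> T. cycle_at X f \<delta> u T \<zeta> \<and> (\<forall>i\<le>t. \<zeta> i = \<xi> i) \<and> t \<le> T \<and> N dvd T)"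

lemma cycle_at_switch_at:
  assumes "cycle_at X f \<delta> u S \<zeta>" "cycle_at X f \<delta> u T \<xi>"
  shows "cycle_at X f \<delta> u (S + T) (switch_at \<zeta> S \<xi>)"
proof -
  have "switch_at \<zeta> S \<xi> 0 = u"
    using assms by (simp add: switch_at_def cycle_at_def)
  with assms show ?thesis
    unfolding cycle_at_def by (auto intro!: pseudo_orbit_switch_at)
qed

lemma cycle_at_multiple:
  assumes "cycle_at X f \<delta> u N \<zeta>"
  shows "\<exists>\<xi>. cycle_at X f \<delta> u (j * N) \<xi>"
proof (induction j)
  case 0
  then show ?case using assms by (auto simp: cycle_at_def)
next
  case (Suc j)
  then show ?case using cycle_at_switch_at[OF assms] by fastforce
qed

lemma returning_switch_at:
  assumes \<zeta>: "cycle_at X f \<delta> u T \<zeta>" and "N dvd T" and \<xi>: "returning X f \<delta> u N \<xi>"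
  shows "returning X f \<delta> u N (switch_at \<zeta> T \<xi>)"
  unfolding returning_def
proof (intro conjI allI)
  show po: "pseudo_orbit X f \<delta> (switch_at \<zeta> T \<xi>)"
    using \<zeta> \<xi> by (auto simp: cycle_at_def returning_def intro!: pseudo_orbit_switch_at)
  show 0: "switch_at \<zeta> T \<xi> 0 = u"
    using \<zeta> \<xi> by (auto simp: cycle_at_def returning_def switch_at_def)
  fix t
  show "\<exists>\<zeta>' T'. cycle_at X f \<delta> u T' \<zeta>' \<and> (\<forall>i\<le>t. \<zeta>' i = switch_at \<zeta> T \<xi> i) \<and> t \<le> T' \<and> N dvd T'"
  proof (cases "t \<le> T")
    case True
    have "cycle_at X f \<delta> u T (switch_at \<zeta> T \<xi>)"
      using po 0 \<xi> by (simp add: cycle_at_def returning_def)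
    with True \<open>N dvd T\<close> show ?thesis by blast
  next
    case False
    obtain \<zeta>' T' where *: "cycle_at X f \<delta> u T' \<zeta>'" "\<forall>i\<le>t - T. \<zeta>' i = \<xi> i" "t - T \<le> T'" "N dvd T'"
      using \<xi> unfolding returning_def by blast
    have "cycle_at X f \<delta> u (T + T') (switch_at \<zeta> T \<zeta>')"
      by (rule cycle_at_switch_at[OF \<zeta> *(1)])
    moreover have "\<forall>i\<le>t. switch_at \<zeta> T \<zeta>' i = switch_at \<zeta> T \<xi> i"
      using *(2) by (auto simp: switch_at_def)
    ultimately show ?thesis
      using *(3,4) \<open>N dvd T\<close> by (intro exI[of _ "switch_at \<zeta> T \<zeta>'"] exI[of _ "T + T'"]) auto
  qed
qed

text \<open>Whole cycles inserted in front delay the sequence. Sequences whose relevant parts start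
  at different indices are aligned in this way.\<close>

lemma returning_pad:
  assumes "cycle_at X f \<delta> u N \<zeta>" "returning X f \<delta> u N \<xi>" "N dvd P"
  shows "\<exists>\<xi>'. returning X f \<delta> u N \<xi>' \<and> (\<forall>t. \<xi>' (P + t) = \<xi> t)"
proof -
  obtain j where "P = j * N" using assms(3) by (auto simp: dvd_def mult.commute)
  then obtain \<theta> where "cycle_at X f \<delta> u P \<theta>" using cycle_at_multiple[OF assms(1)] by blast
  then show ?thesis using returning_switch_at[OF _ assms(3,2)] switch_at_after by blast
qed

text \<open>After a suitable return the remaining time is a multiple of \<open>N\<close> and is
  spent in copies of the cycle \<open>\<zeta>\<close>. The closing time is thus free beyond a
  threshold, which lets finitely many sequences be closed simultaneously.\<close>

lemma returning_closes:
  assumes "cycle_at X f \<delta> u N \<zeta>" "returning X f \<delta> u N \<xi>"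
  shows "\<exists>M. \<forall>T\<ge>M. N dvd T \<longrightarrow> (\<exists>\<theta>. cycle_at X f \<delta> u T \<theta> \<and> (\<forall>i\<le>t. \<theta> i = \<xi> i))"
proof -
  obtain \<zeta>' T' where *: "cycle_at X f \<delta> u T' \<zeta>'" "\<forall>i\<le>t. \<zeta>' i = \<xi> i" "t \<le> T'" "N dvd T'"
    using assms(2) unfolding returning_def by blast
  have "\<exists>\<theta>. cycle_at X f \<delta> u T \<theta> \<and> (\<forall>i\<le>t. \<theta> i = \<xi> i)" if "T' \<le> T" "N dvd T" for T
  proof -
    have "N dvd T - T'" using that *(4) by simp
    then obtain j where "T - T' = N * j" ..
    then have j: "T = T' + j * N" using that by (simp add: mult.commute)
    obtain \<kappa> where \<kappa>: "cycle_at X f \<delta> u (j * N) \<kappa>" using cycle_at_multiple[OF assms(1)] by blast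
    have "\<zeta>' T' = \<kappa> 0" using *(1) \<kappa> by (simp add: cycle_at_def)
    then have "\<forall>i\<le>t. switch_at \<zeta>' T' \<kappa> i = \<xi> i"
      using *(2,3) by (simp add: switch_at_upto)
    with cycle_at_switch_at[OF *(1) \<kappa>] j show ?thesis by blast
  qed
  then show ?thesis by blast
qed

lemma returning_closes_finite:
  assumes "cycle_at X f \<delta> u N \<zeta>" "finite I" "\<And>i. i \<in> I \<Longrightarrow> returning X f \<delta> u N (\<xi> i)"
  shows "\<exists>M. \<forall>T\<ge>M. N dvd T \<longrightarrow>
    (\<forall>i\<in>I. \<exists>\<theta>. cycle_at X f \<delta> u T \<theta> \<and> (\<forall>j\<le>t. \<theta> j = \<xi> i j))"
proof -
  have "\<forall>i\<in>I. \<exists>M. \<forall>T\<ge>M. N dvd T \<longrightarrow> (\<exists>\<theta>. cycle_at X f \<delta> u T \<theta> \<and> (\<forall>j\<le>t. \<theta> j = \<xi> i j))"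
    using returning_closes[OF assms(1)] assms(3) by blast
  then obtain M where M: "\<forall>i\<in>I. \<forall>T\<ge>M i. N dvd T \<longrightarrow>
      (\<exists>\<theta>. cycle_at X f \<delta> u T \<theta> \<and> (\<forall>j\<le>t. \<theta> j = \<xi> i j))" by metis
  have "M i \<le> Max (insert 0 (M ` I))" if "i \<in> I" for i
    using that assms(2) by simp
  with M have "\<forall>T\<ge>Max (insert 0 (M ` I)). N dvd T \<longrightarrow>
      (\<forall>i\<in>I. \<exists>\<theta>. cycle_at X f \<delta> u T \<theta> \<and> (\<forall>j\<le>t. \<theta> j = \<xi> i j))"
    using order_trans by blast
  then show ?thesis by blast
qed

lemma concat_cycles:
  assumes cyc: "\<And>i. cycle_at X f \<delta> u (a (Suc i) - a i) (g i)" and a: "a 0 = 0" "strict_mono a"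
  shows "\<exists>\<rho>. pseudo_orbit X f \<delta> \<rho> \<and> (\<forall>i t. a i + t \<le> a (Suc i) \<longrightarrow> \<rho> (a i + t) = g i t)"
proof -
  \<comment> \<open>The block containing \<open>t\<close>; strict monotonicity of \<open>a\<close>
    makes it unique.\<close>
  define idx where "idx t = (LEAST i. t < a (Suc i))" for t
  have "t < a (Suc t)" for t
    using strict_mono_imp_increasing[OF a(2), of "Suc t"] by simp
  then have lt: "t < a (Suc (idx t))" for t
    unfolding idx_def by (rule LeastI[of _ t])
  have ge: "a (idx t) \<le> t" for t
  proof (cases "idx t")
    case (Suc j)
    then show ?thesis using not_less_Least[of j "\<lambda>i. t < a (Suc i)"] by (auto simp: idx_def)
  qed (simp add: a)
  have idx: "idx t = i" if "a i \<le> t" "t < a (Suc i)" for i t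
  proof -
    have "a i < a (Suc (idx t))" "a (idx t) < a (Suc i)"
      using lt[of t] ge[of t] that by linarith+
    then show ?thesis by (simp add: strict_mono_less[OF a(2)])
  qed
  define \<rho> where "\<rho> t = g (idx t) (t - a (idx t))" for t
  have inc: "a i < a (Suc i)" for i using a(2) by (simp add: strict_mono_Suc_iff)
  \<comment> \<open>The right end of a block is included: there the value is the start
    \<open>u\<close> of the next cycle, which is also the end of \<open>g i\<close>. A step across a
    boundary is therefore a step of one cycle.\<close>
  have \<rho>: "\<rho> (a i + t) = g i t" if "a i + t \<le> a (Suc i)" for i t
  proof (cases "a i + t < a (Suc i)")
    case True
    then show ?thesis using idx[of i "a i + t"] by (simp add: \<rho>_def)
  next
    case False
    then have eq: "a i + t = a (Suc i)" using that by simp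
    have "\<rho> (a (Suc i)) = g (Suc i) 0" 
      using inc[of "Suc i"] idx[of "Suc i" "a (Suc i)"] by (simp add: \<rho>_def)
    moreover have "t = a (Suc i) - a i" using eq by simp
    ultimately show ?thesis using cyc eq by (simp add: cycle_at_def)
  qed
  have "dist (f (\<rho> t)) (\<rho> (Suc t)) \<le> \<delta>" for t
  proof -
    have "\<rho> (Suc t) = g (idx t) (Suc (t - a (idx t)))"
      using \<rho>[of "idx t" "Suc (t - a (idx t))"] lt[of t] ge[of t] by simp
    then show ?thesis using cyc by (simp add: \<rho>_def cycle_at_def pseudo_orbit_def)
  qed
  moreover have "\<rho> t \<in> X" for t
    using cyc by (simp add: \<rho>_def cycle_at_def pseudo_orbit_def)
  ultimately show ?thesis using \<rho> by (auto simp: pseudo_orbit_def)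
qed

section \<open>Pseudo-orbits made of orbit segments of a compact system\<close>

locale compact_system =
  fixes X :: "'a::metric_space set" and f :: "'a \<Rightarrow> 'a"
  assumes compact: "compact X" and continuous: "continuous_on X f" and maps: "f ` X \<subseteq> X"
begin

lemma funpow_in: "x \<in> X \<Longrightarrow> (f ^^ t) x \<in> X"
  using maps by (induction t) auto

lemma continuous_funpow: "continuous_on X (f ^^ t)"
proof (induction t)
  case (Suc t)
  have "continuous_on ((f ^^ t) ` X) f"
    by (rule continuous_on_subset[OF continuous]) (use funpow_in in auto)
  then show ?case using continuous_on_compose[OF Suc] by simp
qed simp

lemma funpow_add_apply: "(f ^^ (s + t)) x = (f ^^ s) ((f ^^ t) x)"
  by (simp add: funpow_add)

lemma pseudo_orbit_orbit: "x \<in> X \<Longrightarrow> \<delta> \<ge> 0 \<Longrightarrow> pseudo_orbit X f \<delta> (\<lambda>t. (f ^^ t) x)"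
  by (simp add: pseudo_orbit_def funpow_in)

lemma pseudo_orbit_start:
  assumes "u \<in> X" "p \<in> X" "dist (f u) (f p) \<le> \<delta>"
  shows "pseudo_orbit X f \<delta> (\<lambda>t. if t = 0 then u else (f ^^ t) p)"
  using assms funpow_in[OF assms(2)] order_trans[OF zero_le_dist assms(3)]
  by (auto simp: pseudo_orbit_def)

text \<open>Each jump gets only half of \<open>\<delta>\<close> because for \<open>T = 1\<close>
  both fall into the same step and add up.\<close>

lemma pseudo_orbit_start_jump:
  assumes "u \<in> X" "p \<in> X" "T > 0" "dist (f u) (f p) \<le> \<delta> / 2" "dist ((f ^^ T) p) (\<xi> 0) \<le> \<delta> / 2"
    and "pseudo_orbit X f \<delta> \<xi>"
  shows "pseudo_orbit X f \<delta> (switch_at (\<lambda>t. if t = 0 then u else (f ^^ t) p) T \<xi>)"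
proof -
  have \<delta>: "\<delta> \<ge> 0" using order_trans[OF zero_le_dist assms(4)] by simp
  define s where "s = (\<lambda>t. if t = 0 then u else (f ^^ t) p)"
  have "pseudo_orbit X f \<delta> s"
    unfolding s_def using assms \<delta> by (intro pseudo_orbit_start) auto
  moreover have "dist (f (s (T - 1))) (\<xi> 0) \<le> \<delta>"
  proof (cases "T = 1")
    case True
    then show ?thesis using assms(4,5) dist_triangle[of "f u" "\<xi> 0" "f p"] by (simp add: s_def)
  next
    case False
    then have "(f ^^ T) p = f (s (T - 1))"
      using \<open>T > 0\<close> by (cases T) (auto simp: s_def)
    then show ?thesis using assms(5) \<delta> by simp
  qed
  ultimately show ?thesis
    unfolding s_def[symmetric] using assms(6) by (intro pseudo_orbit_jump)
qed

lemma cycle_through_orbit: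
  assumes "u \<in> X" "p \<in> X" "T > 0" "dist (f u) (f p) \<le> \<delta> / 2" "dist ((f ^^ T) p) u \<le> \<delta> / 2"
  shows "\<exists>\<zeta>. cycle_at X f \<delta> u T \<zeta> \<and> (\<forall>t<T. \<zeta> t = (if t = 0 then u else (f ^^ t) p))"
proof -
  have \<delta>: "\<delta> \<ge> 0" using order_trans[OF zero_le_dist assms(4)] by simp
  let ?\<zeta> = "switch_at (\<lambda>t. if t = 0 then u else (f ^^ t) p) T (\<lambda>t. (f ^^ t) u)"
  have "pseudo_orbit X f \<delta> ?\<zeta>"
    using assms pseudo_orbit_orbit[OF \<open>u \<in> X\<close> \<delta>] by (intro pseudo_orbit_start_jump) auto
  then have "cycle_at X f \<delta> u T ?\<zeta>"
    using \<open>T > 0\<close> by (simp add: cycle_at_def switch_at_before)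
  then show ?thesis
    by (intro exI[of _ ?\<zeta>]) (simp add: switch_at_before)
qed

end

section \<open>Lifting along a shadowing orbit\<close>

text \<open>The padding \<open>(fact i - 1) * r\<close> makes \<open>b i + r\<close> divisible by \<open>fact i\<close>; this keeps the total
  time shift of a pseudo-orbit that is lifted repeatedly divisible by the current period.\<close>

lemma universal_pseudo_orbit:
  fixes \<xi> :: "'i::countable \<Rightarrow> nat \<Rightarrow> 'a::metric_space"
  assumes "N > 0" and cyc: "cycle_at X f \<delta> u N \<kappa>"
    and ret: "\<And>s. returning X f \<delta> u N (\<xi> s)" and r: "\<And>s. N dvd r s"
  shows "\<exists>\<rho> a b lab. pseudo_orbit X f \<delta> \<rho> \<and> strict_mono a \<and>
    (\<forall>i. fact i dvd a i \<and> fact i dvd b i + r (lab i) \<and> a i \<le> b i \<and> b i + i \<le> a (Suc i) \<and>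
      (\<forall>t\<le>i. \<rho> (b i + t) = \<xi> (lab i) t)) \<and>
    (\<forall>s::'i. infinite {i. lab i = s})"
proof -
  \<comment> \<open>The second component of the decoded pair is free, so every label occurs
    infinitely often.\<close>
  define lab :: "nat \<Rightarrow> 'i" where "lab i = from_nat (fst (prod_decode i))" for i
  define P where "P i = (fact i - 1) * r (lab i)" for i :: nat
  have "\<exists>\<xi>'. returning X f \<delta> u N \<xi>' \<and> (\<forall>t. \<xi>' (P i + t) = \<xi> (lab i) t)" for i
    using r by (intro returning_pad[OF cyc ret]) (simp add: P_def)
  then obtain \<eta> where \<eta>: "\<And>i. returning X f \<delta> u N (\<eta> i)" "\<And>i t. \<eta> i (P i + t) = \<xi> (lab i) t"
    by metis
  have "\<exists>M. \<forall>T\<ge>M. N dvd T \<longrightarrow> (\<exists>\<theta>. cycle_at X f \<delta> u T \<theta> \<and> (\<forall>j\<le>P i + i. \<theta> j = \<eta> i j))" for i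
    by (rule returning_closes[OF cyc \<eta>(1)])
  then obtain M where M: "\<And>i T. T \<ge> M i \<Longrightarrow> N dvd T \<Longrightarrow>
      \<exists>\<theta>. cycle_at X f \<delta> u T \<theta> \<and> (\<forall>j\<le>P i + i. \<theta> j = \<eta> i j)"
    by metis
  \<comment> \<open>The factor makes block lengths multiples of \<open>N\<close> and block starts
    multiples of the required factorials; the summands leave room for the closing threshold
    \<open>M i\<close>, the padding and \<open>i\<close> further steps.\<close>
  define a where "a = rec_nat 0 (\<lambda>i ai. N * fact (Suc i) * (M i + P i + i + ai + 1))"
  have a0: "a 0 = 0" and aS: "a (Suc i) = N * fact (Suc i) * (M i + P i + i + a i + 1)" for i
    by (simp_all add: a_def)
  have "N * fact (Suc i) * k \<ge> k" for i k :: nat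
  proof -
    have "1 \<le> N * fact (Suc i)"
      using \<open>N > 0\<close> by (metis One_nat_def Suc_leI fact_gt_zero nat_0_less_mult_iff)
    then show ?thesis using mult_le_mono1[of 1 "N * fact (Suc i)" k] by simp
  qed
  then have grow: "a (Suc i) \<ge> M i + P i + i + a i + 1" for i
    unfolding aS by blast
  then have mono: "strict_mono a"
  proof -
    have "a i < a (Suc i)" for i using grow[of i] by linarith
    then show ?thesis by (simp add: strict_mono_Suc_iff)
  qed
  have N: "N dvd a i" for i
    by (cases i) (simp_all add: a0 aS)
  have fact: "fact i dvd a i" for i
  proof (cases i)
    case (Suc k)
    have "fact (Suc k) dvd N * fact (Suc k) * (M k + P k + k + a k + 1)"
      by (intro dvd_mult2 dvd_triv_right)
    then show ?thesis by (simp only: Suc aS)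
  qed (simp add: a0)
  have "\<exists>\<theta>. cycle_at X f \<delta> u (a (Suc i) - a i) \<theta> \<and> (\<forall>j\<le>P i + i. \<theta> j = \<eta> i j)" for i
    using grow[of i] N by (intro M) auto
  then obtain g where g: "\<And>i. cycle_at X f \<delta> u (a (Suc i) - a i) (g i)"
    "\<And>i j. j \<le> P i + i \<Longrightarrow> g i j = \<eta> i j"
    by metis
  obtain \<rho> where \<rho>: "pseudo_orbit X f \<delta> \<rho>" "\<And>i t. a i + t \<le> a (Suc i) \<Longrightarrow> \<rho> (a i + t) = g i t"
    using concat_cycles[OF g(1) a0 mono] by blast
  have "\<rho> (a i + P i + t) = \<xi> (lab i) t" if "t \<le> i" for i t
    using \<rho>(2)[of i "P i + t"] grow[of i] g(2)[of "P i + t" i] \<eta>(2) that by (simp add: add.assoc)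
  moreover have "fact i dvd a i + P i + r (lab i)" for i
  proof -
    have "P i + r (lab i) = fact i * r (lab i)"
      using fact_ge_1[of i, where 'a = nat] by (simp add: P_def diff_mult_distrib)
    then have "a i + P i + r (lab i) = a i + fact i * r (lab i)" by simp
    then show ?thesis using fact[of i] dvd_add dvd_triv_left by metis
  qed
  moreover have "infinite {i. lab i = s}" for s
    unfolding infinite_nat_iff_unbounded_le
  proof
    fix m
    have "lab (prod_encode (to_nat s, m)) = s" by (simp add: lab_def)
    then show "\<exists>n\<ge>m. n \<in> {i. lab i = s}"
      using le_prod_encode_2 by blast
  qed
  moreover have room: "a i + P i + i \<le> a (Suc i)" for i
    using grow[of i] by simp
  ultimately show ?thesis
    using \<rho>(1) mono fact room
    by (intro exI[of _ \<rho>] exI[of _ a] exI[of _ "\<lambda>i. a i + P i"] exI[of _ lab]) simp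
qed

context compact_system
begin

lemma subsequence_limit:
  assumes "\<And>m. g m \<in> X"
  obtains z q where "z \<in> X" "strict_mono (q :: nat \<Rightarrow> nat)" "(\<lambda>m. g (q m)) \<longlonglongrightarrow> z"
proof -
  have "seq_compact X" using compact by (simp add: compact_imp_seq_compact)
  then show ?thesis
    using assms that unfolding seq_compact_def comp_def by metis
qed

lemma funpow_tendsto:
  assumes "g \<longlonglongrightarrow> z" "z \<in> X" "\<And>m. g m \<in> X"
  shows "(\<lambda>m. (f ^^ t) (g m)) \<longlonglongrightarrow> (f ^^ t) z"
  using continuous_on_tendsto_compose[OF continuous_funpow assms(1,2)] assms(3) by simp

text \<open>The visits at times \<open>a (q m)\<close> converge to \<open>u\<close>, and those at
  times \<open>b (j m)\<close> with label \<open>s\<close> to some \<open>z\<close>. The sequence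
  \<open>\<xi> s\<close> starts at \<open>u\<close>, follows the orbit of \<open>x\<close> from a
  visit near \<open>u\<close> to one near \<open>z\<close>, then jumps to the orbit of
  \<open>z\<close> and stays there. It can always return, since the orbit of \<open>x\<close> passes
  close to each point of the orbit of \<open>z\<close> and later close to \<open>u\<close>.\<close>

lemma returning_along_orbit:
  fixes a b :: "nat \<Rightarrow> nat" and r :: "'i \<Rightarrow> nat"
  assumes "x \<in> X" and "\<delta> > 0" and mono: "strict_mono a"
    and ab: "\<And>i. fact i dvd a i" "\<And>i. fact i dvd b i + r (lab i)" "\<And>i. a i \<le> b i"
      "\<And>i. b i + i \<le> a (Suc i)"
    and inf: "\<And>s. infinite {i. lab i = s}"
  shows "\<exists>u N \<zeta> \<xi> R. N > 0 \<and> cycle_at X f \<delta> u N \<zeta> \<and>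
    (\<forall>s. returning X f \<delta> u N (\<xi> s) \<and> N dvd R s + r s \<and>
      (\<forall>t. \<exists>j. strict_mono j \<and> (\<forall>m. lab (j m) = s) \<and>
        (\<lambda>m. (f ^^ (b (j m) + t)) x) \<longlonglongrightarrow> \<xi> s (R s + t)))"
proof -
  have inX: "(f ^^ t) x \<in> X" for t using funpow_in[OF \<open>x \<in> X\<close>] .
  obtain u q where u: "u \<in> X" and q: "strict_mono q" and lim: "(\<lambda>m. (f ^^ a (q m)) x) \<longlonglongrightarrow> u"
    using subsequence_limit[of "\<lambda>m. (f ^^ a m) x"] inX by blast
  have "\<forall>\<^sub>F m in sequentially. dist ((f ^^ a (q m)) x) u < \<delta> / 2 \<and>
      dist (f ((f ^^ a (q m)) x)) (f u) < \<delta> / 2"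
    using tendstoD[OF lim, of "\<delta> / 2"] tendstoD[OF funpow_tendsto[OF lim u, of 1], of "\<delta> / 2"] inX \<open>\<delta> > 0\<close>
    by (simp add: eventually_conj)
  then obtain m0 where "\<And>m. m \<ge> m0 \<Longrightarrow> dist ((f ^^ a (q m)) x) u < \<delta> / 2 \<and>
      dist (f ((f ^^ a (q m)) x)) (f u) < \<delta> / 2"
    unfolding eventually_sequentially by blast
  then have near: "dist ((f ^^ a (q m)) x) u \<le> \<delta> / 2" "dist (f u) (f ((f ^^ a (q m)) x)) \<le> \<delta> / 2"
    if "m \<ge> m0" for m
    using that by (simp_all add: less_imp_le dist_commute)
  \<comment> \<open>The time between two visits close to \<open>u\<close> gives the base cycle. From
    here on \<open>N\<close> is fixed, and divisibility comes from indices \<open>i \<ge> N\<close>,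
    for which \<open>N\<close> divides \<open>fact i\<close>.\<close>
  define N where "N = a (q (Suc m0)) - a (q m0)"
  have "a (q m0) < a (q (Suc m0))"
    using mono q by (simp add: strict_mono_less)
  then have N: "N > 0" "a (q (Suc m0)) = N + a (q m0)" by (auto simp: N_def)
  have "dist ((f ^^ N) ((f ^^ a (q m0)) x)) u \<le> \<delta> / 2"
    using near(1)[of "Suc m0"] by (simp add: N(2) funpow_add)
  then obtain \<zeta> where \<zeta>: "cycle_at X f \<delta> u N \<zeta>"
    using cycle_through_orbit[OF u inX N(1) near(2)[OF order_refl]] by blast
  have Nfact: "N dvd k" if "N \<le> i" "fact i dvd k" for i k
    using that N(1) dvd_trans[OF dvd_fact, of N i k] by simp
  define i3 where "i3 = q (max m0 N)"
  have i3: "N \<le> i3" using seq_suble[OF q, of "max m0 N"] by (simp add: i3_def)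
  define p where "p = (f ^^ a i3) x"
  have p: "p \<in> X" "dist (f u) (f p) \<le> \<delta> / 2"
    using inX near(2)[of "max m0 N"] by (simp_all add: p_def i3_def)
  define start where "start = (\<lambda>t. if t = 0 then u else (f ^^ t) p)"
  have visit: "\<exists>\<beta>\<ge>k. dist ((f ^^ \<beta>) x) u \<le> \<delta> / 2 \<and> N dvd \<beta>" for k
  proof -
    let ?m = "max k (max m0 N)"
    have "?m \<le> q ?m" "q ?m \<le> a (q ?m)" using seq_suble q mono by blast+
    then show ?thesis
      using near(1)[of ?m] Nfact[OF _ ab(1), of "q ?m"] by (intro exI[of _ "a (q ?m)"]) auto
  qed
  have "\<exists>\<xi> R. returning X f \<delta> u N \<xi> \<and> N dvd R + r s \<and>
      (\<forall>t. \<exists>j. strict_mono j \<and> (\<forall>m. lab (j m) = s) \<and>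
        (\<lambda>m. (f ^^ (b (j m) + t)) x) \<longlonglongrightarrow> \<xi> (R + t))" for s
  proof -
    obtain e :: "nat \<Rightarrow> nat" where e: "strict_mono e" "\<And>n. lab (e n) = s"
      using infinite_enumerate[OF inf[of s]] by blast
    obtain z q' where z: "z \<in> X" and q': "strict_mono q'" and limz: "(\<lambda>m. (f ^^ b (e (q' m))) x) \<longlonglongrightarrow> z"
      using subsequence_limit[of "\<lambda>m. (f ^^ b (e m)) x"] inX by blast
    define j where "j m = e (q' m)" for m
    have j: "strict_mono j" "\<And>m. lab (j m) = s"
      using e q' by (auto simp: j_def strict_mono_def)
    have jge: "m \<le> j m" for m using seq_suble[OF j(1)] .
    have limt: "(\<lambda>m. (f ^^ (b (j m) + t)) x) \<longlonglongrightarrow> (f ^^ t) z" for t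
      using funpow_tendsto[OF limz z, of t] inX by (simp add: j_def funpow_add add.commute)
    have close: "\<exists>m\<ge>k. dist ((f ^^ (b (j m) + t)) x) ((f ^^ t) z) \<le> \<delta> / 2" for k t
    proof -
      have "\<forall>\<^sub>F m in sequentially. dist ((f ^^ (b (j m) + t)) x) ((f ^^ t) z) < \<delta> / 2 \<and> k \<le> m"
        using tendstoD[OF limt, of "\<delta> / 2" t] \<open>\<delta> > 0\<close> by (simp add: eventually_conj eventually_ge_at_top)
      then show ?thesis
        using eventually_happens'[OF sequentially_bot] by fastforce
    qed
    obtain m2 where m2: "m2 \<ge> Suc i3" "dist ((f ^^ b (j m2)) x) z \<le> \<delta> / 2"
      using close[of "Suc i3" 0] by auto
    define R where "R = b (j m2) - a i3"
    have "i3 < j m2" using m2(1) jge[of m2] by simp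
    then have "a i3 < b (j m2)"
      using ab(3)[of "j m2"] mono by (meson less_le_trans strict_mono_less)
    then have R: "R > 0" "b (j m2) = R + a i3" by (auto simp: R_def)
    have Nb: "N dvd b (j m) + r s" if "m \<ge> N" for m
      using Nfact[OF _ ab(2), of "j m"] jge[of m] that j(2) by simp
    have Na: "N dvd a i3" by (rule Nfact[OF i3 ab(1)])
    have NR: "N dvd R + r s"
    proof -
      have "N dvd (R + r s) + a i3"
        using Nb[of m2] m2(1) i3 R(2) by (simp add: ac_simps)
      then show ?thesis using Na dvd_add_left_iff by blast
    qed
    have orbz: "pseudo_orbit X f \<delta> (\<lambda>t. (f ^^ t) z)" and orbu: "pseudo_orbit X f \<delta> (\<lambda>t. (f ^^ t) u)"
      and orbx: "pseudo_orbit X f \<delta> (\<lambda>t. (f ^^ t) ((f ^^ k) x))" for k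
      using pseudo_orbit_orbit z u inX \<open>\<delta> > 0\<close> by auto
    define \<xi> where "\<xi> = switch_at start R (\<lambda>t. (f ^^ t) z)"
    have "(f ^^ R) p = (f ^^ b (j m2)) x"
      by (simp add: R(2) p_def funpow_add)
    then have po: "pseudo_orbit X f \<delta> \<xi>"
      unfolding \<xi>_def start_def
      using m2(2) by (intro pseudo_orbit_start_jump[OF u p(1) R(1) p(2) _ orbz]) simp
    have \<xi>0: "\<xi> 0 = u" using R(1) by (simp add: \<xi>_def switch_at_def start_def)
    have \<xi>R: "\<xi> (R + t) = (f ^^ t) z" for t by (simp add: \<xi>_def)
    have "\<exists>\<theta> T. cycle_at X f \<delta> u T \<theta> \<and> (\<forall>i\<le>t. \<theta> i = \<xi> i) \<and> t \<le> T \<and> N dvd T" for t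
    proof (cases "t < R")
      case True
      \<comment> \<open>Before time \<open>R\<close> the sequence is still on the orbit of
        \<open>x\<close>; it stays on it until a later visit near \<open>u\<close>.\<close>
      obtain \<beta> where \<beta>: "\<beta> \<ge> R + a i3" "dist ((f ^^ \<beta>) x) u \<le> \<delta> / 2" "N dvd \<beta>"
        using visit by blast
      define T where "T = \<beta> - a i3"
      have T: "R \<le> T" "\<beta> = T + a i3" using \<beta>(1) by (auto simp: T_def)
      have "(f ^^ T) p = (f ^^ \<beta>) x" by (simp add: T(2) p_def funpow_add)
      then have "pseudo_orbit X f \<delta> (switch_at start T (\<lambda>t. (f ^^ t) u))"
        unfolding start_def using \<beta>(2) T(1) R(1) p
        by (intro pseudo_orbit_start_jump[OF u _ _ _ _ orbu]) auto
      then have "cycle_at X f \<delta> u T (switch_at start T (\<lambda>t. (f ^^ t) u))"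
        using T(1) R(1) by (simp add: cycle_at_def switch_at_before start_def)
      moreover have "\<forall>i\<le>t. switch_at start T (\<lambda>t. (f ^^ t) u) i = \<xi> i"
        using True T(1) by (simp add: \<xi>_def switch_at_def)
      moreover have "N dvd T" using \<beta>(3) Na T(2) dvd_add_left_iff by blast
      moreover have "t \<le> T" using True T(1) by simp
      ultimately show ?thesis by blast
    next
      case False
      define v where "v = t - R"
      have v: "t = R + v" using False by (simp add: v_def)
      \<comment> \<open>From the orbit of \<open>z\<close> the path jumps back to the orbit of
        \<open>x\<close>. The target is one step ahead, because it is compared with the image of
        \<open>\<xi> t\<close> under \<open>f\<close>.\<close>
      obtain m where m: "m \<ge> N" "dist ((f ^^ (b (j m) + Suc v)) x) ((f ^^ Suc v) z) \<le> \<delta> / 2"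
        using close by blast
      define k where "k = b (j m) + Suc v"
      obtain \<beta> where \<beta>: "\<beta> \<ge> Suc k" "dist ((f ^^ \<beta>) x) u \<le> \<delta> / 2" "N dvd \<beta>"
        using visit by blast
      define D where "D = \<beta> - k"
      have D: "D > 0" "\<beta> = D + k" using \<beta>(1) by (auto simp: D_def)
      define tail where "tail = switch_at (\<lambda>t. (f ^^ t) ((f ^^ k) x)) D (\<lambda>t. (f ^^ t) u)"
      have "f ((f ^^ (D - 1)) ((f ^^ k) x)) = (f ^^ \<beta>) x"
      proof -
        obtain D' where "D = Suc D'" using D(1) gr0_conv_Suc by blast
        then show ?thesis by (simp add: D(2) funpow_add)
      qed
      then have tail: "pseudo_orbit X f \<delta> tail"
        unfolding tail_def using \<beta>(2) \<open>\<delta> > 0\<close>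
        by (intro pseudo_orbit_jump[OF orbx orbu]) simp
      have tail0: "tail 0 = (f ^^ k) x" using D(1) by (simp add: tail_def switch_at_def)
      have "dist (f (\<xi> t)) (tail 0) \<le> \<delta>"
        using m(2) \<open>\<delta> > 0\<close> unfolding tail0 k_def v \<xi>R by (simp add: dist_commute)
      then have "pseudo_orbit X f \<delta> (switch_at \<xi> (Suc t) tail)"
        by (intro pseudo_orbit_jump[OF po tail]) simp
      moreover have "switch_at \<xi> (Suc t) tail 0 = u" by (simp add: switch_at_before \<xi>0)
      moreover have "switch_at \<xi> (Suc t) tail (Suc t + D) = u"
        unfolding switch_at_after by (simp add: tail_def)
      ultimately have "cycle_at X f \<delta> u (Suc t + D) (switch_at \<xi> (Suc t) tail)"
        by (simp only: cycle_at_def)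
      moreover have "\<forall>i\<le>t. switch_at \<xi> (Suc t) tail i = \<xi> i"
        by (simp add: switch_at_def)
      moreover have "N dvd Suc t + D"
      proof -
        \<comment> \<open>Modulo \<open>N\<close> both \<open>b (j m)\<close> and \<open>R\<close>
          equal the negative of \<open>r s\<close>, so these remainders cancel.\<close>
        have eq: "(Suc t + D) + (b (j m) + r s) = (R + r s) + \<beta>"
          by (simp add: D(2) k_def v)
        have "N dvd (Suc t + D) + (b (j m) + r s)"
          unfolding eq by (rule dvd_add[OF NR \<beta>(3)])
        then show ?thesis using Nb[OF m(1)] dvd_add_left_iff by blast
      qed
      moreover have "t \<le> Suc t + D" by simp
      ultimately show ?thesis by blast
    qed
    then have "returning X f \<delta> u N \<xi>" using po \<xi>0 by (simp add: returning_def)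
    moreover have "\<forall>t. \<exists>j. strict_mono j \<and> (\<forall>m. lab (j m) = s) \<and>
        (\<lambda>m. (f ^^ (b (j m) + t)) x) \<longlonglongrightarrow> \<xi> (R + t)"
      using j limt unfolding \<xi>R by blast
    ultimately show ?thesis using NR by blast
  qed
  then obtain \<xi> R where "\<And>s. returning X f \<delta> u N (\<xi> s) \<and> N dvd R s + r s \<and>
      (\<forall>t. \<exists>j. strict_mono j \<and> (\<forall>m. lab (j m) = s) \<and>
        (\<lambda>m. (f ^^ (b (j m) + t)) x) \<longlonglongrightarrow> \<xi> s (R s + t))"
    by metis
  with N(1) \<zeta> show ?thesis by blast
qed

text \<open>A shadowing point of the universal pseudo-orbit is fed to the previous lemma. The bound
  \<open>\<epsilon>\<close> passes to limits, so tracking holds for all time, while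
  \<open>\<delta>'\<close> may be arbitrarily small because the new sequences use recurrence of a
  genuine orbit. Divisibility of \<open>R s + r s\<close> keeps accumulated offsets compatible with
  the new period.\<close>

lemma lift_returning:
  fixes \<xi> :: "'i::countable \<Rightarrow> nat \<Rightarrow> 'a"
  assumes shadow: "\<And>\<rho>. pseudo_orbit X f \<delta> \<rho> \<Longrightarrow> \<exists>x\<in>X. \<forall>t. dist ((f ^^ t) x) (\<rho> t) \<le> \<epsilon>"
    and "N > 0" "cycle_at X f \<delta> u N \<kappa>"
    and "\<And>s. returning X f \<delta> u N (\<xi> s)" "\<And>s. N dvd r s" and "\<delta>' > 0"
  shows "\<exists>u' N' \<zeta> \<xi>' R. N' > 0 \<and> cycle_at X f \<delta>' u' N' \<zeta> \<and>
    (\<forall>s. returning X f \<delta>' u' N' (\<xi>' s) \<and> N' dvd R s + r s \<and>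
      (\<forall>t. dist (\<xi>' s (R s + t)) (\<xi> s t) \<le> \<epsilon>))"
proof -
  from universal_pseudo_orbit[where \<xi> = \<xi> and r = r, OF assms(2-5)] obtain \<rho> a b lab
    where *: "pseudo_orbit X f \<delta> \<rho> \<and> strict_mono a \<and>
      (\<forall>i. fact i dvd a i \<and> fact i dvd b i + r (lab i) \<and> a i \<le> b i \<and> b i + i \<le> a (Suc i) \<and>
        (\<forall>t\<le>i. \<rho> (b i + t) = \<xi> (lab i) t)) \<and> (\<forall>s. infinite {i. lab i = s})"
    by (elim exE)
  then have \<rho>: "pseudo_orbit X f \<delta> \<rho>" and a: "strict_mono a"
    and ab: "\<And>i. fact i dvd a i" "\<And>i. fact i dvd b i + r (lab i)" "\<And>i. a i \<le> b i"
      "\<And>i. b i + i \<le> a (Suc i)"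
    and \<rho>b: "\<And>i t. t \<le> i \<Longrightarrow> \<rho> (b i + t) = \<xi> (lab i) t"
    and inf: "\<And>s. infinite {i. lab i = s}"
    by blast+
  obtain x where "x \<in> X" and x: "\<And>t. dist ((f ^^ t) x) (\<rho> t) \<le> \<epsilon>"
    using shadow[OF \<rho>] by blast
  have dist: "dist y (\<xi> s t) \<le> \<epsilon>"
    if j: "strict_mono j" "\<forall>m. lab (j m) = s" and lim: "(\<lambda>m. (f ^^ (b (j m) + t)) x) \<longlonglongrightarrow> y" for j s t y
  proof -
    have lim': "(\<lambda>m. dist ((f ^^ (b (j m) + t)) x) (\<xi> s t)) \<longlonglongrightarrow> dist y (\<xi> s t)"
      by (intro tendsto_intros lim)
    have "dist ((f ^^ (b (j m) + t)) x) (\<xi> s t) \<le> \<epsilon>" if "m \<ge> t" for m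
    proof -
      have "t \<le> j m" using seq_suble[OF j(1), of m] that by (rule order_trans[rotated])
      then have "\<rho> (b (j m) + t) = \<xi> s t" using \<rho>b j(2) by metis
      then show ?thesis using x[of "b (j m) + t"] by metis
    qed
    then show ?thesis by (intro Lim_bounded[OF lim']) blast
  qed
  have "\<exists>u N \<zeta> \<xi>' R. N > 0 \<and> cycle_at X f \<delta>' u N \<zeta> \<and>
    (\<forall>s. returning X f \<delta>' u N (\<xi>' s) \<and> N dvd R s + r s \<and>
      (\<forall>t. \<exists>j. strict_mono j \<and> (\<forall>m. lab (j m) = s) \<and>
        (\<lambda>m. (f ^^ (b (j m) + t)) x) \<longlonglongrightarrow> \<xi>' s (R s + t)))"
    using \<open>x \<in> X\<close> \<open>\<delta>' > 0\<close> a ab inf by (rule returning_along_orbit)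
  then obtain u' N' \<zeta> \<xi>' R where *: "N' > 0" "cycle_at X f \<delta>' u' N' \<zeta>"
    "\<And>s. returning X f \<delta>' u' N' (\<xi>' s) \<and> N' dvd R s + r s"
    "\<And>s t. \<exists>j. strict_mono j \<and> (\<forall>m. lab (j m) = s) \<and>
        (\<lambda>m. (f ^^ (b (j m) + t)) x) \<longlonglongrightarrow> \<xi>' s (R s + t)"
    by blast
  have "dist (\<xi>' s (R s + t)) (\<xi> s t) \<le> \<epsilon>" for s t
    using *(4)[of s t] by (elim exE conjE) (rule dist)
  with *(1-3) show ?thesis by blast
qed

end

section \<open>Separated cycles from positive entropy\<close>

definition alternation :: "nat \<Rightarrow> (nat \<Rightarrow> 'a) \<Rightarrow> (nat \<Rightarrow> 'a) \<Rightarrow> nat \<Rightarrow> nat \<Rightarrow> 'a" where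
  "alternation L a b s t = (if s + 2 dvd t div L then b else a) (t mod L)"

lemma returning_alternation:
  assumes "L > 0" and a: "cycle_at X f \<delta> u L a" and b: "cycle_at X f \<delta> u L b"
  shows "returning X f \<delta> u L (alternation L a b s)"
proof -
  define w where "w j = (if s + 2 dvd j then b else a)" for j :: nat
  have w: "cycle_at X f \<delta> u L (w j)" for j using a b by (simp add: w_def)
  have alt: "alternation L a b s t = w (t div L) (t mod L)" for t
    by (simp add: alternation_def w_def)
  have mult: "alternation L a b s (L * j) = u" for j
    using w[of j] \<open>L > 0\<close> by (simp add: alt cycle_at_def)
  have "dist (f (alternation L a b s t)) (alternation L a b s (Suc t)) \<le> \<delta>" for t
  proof -
    have step: "dist (f (w (t div L) (t mod L))) (w (t div L) (Suc (t mod L))) \<le> \<delta>"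
      using w[of "t div L"] by (simp add: cycle_at_def pseudo_orbit_def)
    have "alternation L a b s (Suc t) = w (t div L) (Suc (t mod L))"
    proof (cases "Suc (t mod L) = L")
      case True
      then have "Suc t = L * Suc (t div L)"
        by (metis add_Suc_right mult_Suc_right mult_div_mod_eq add.commute)
      then show ?thesis
        using w[of "t div L"] mult[of "Suc (t div L)"] True unfolding cycle_at_def by metis
    next
      case False
      then show ?thesis by (simp add: alt div_Suc mod_Suc)
    qed
    with step show ?thesis by (simp add: alt)
  qed
  moreover have "alternation L a b s t \<in> X" for t
    using w[of "t div L"] by (simp add: alt cycle_at_def pseudo_orbit_def)
  ultimately have po: "pseudo_orbit X f \<delta> (alternation L a b s)"
    by (simp add: pseudo_orbit_def)
  moreover have 0: "alternation L a b s 0 = u" using mult[of 0] by simp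
  \<comment> \<open>Every multiple of \<open>L\<close> is a return time, so the sequence is its own
    closing cycle.\<close>
  ultimately have "cycle_at X f \<delta> u (L * j) (alternation L a b s)" for j
    using mult by (simp add: cycle_at_def)
  moreover have "t \<le> L * Suc (t div L)" for t
    using \<open>L > 0\<close> by (simp add: dividend_less_times_div less_imp_le)
  ultimately show ?thesis
    using po 0 dvd_triv_left unfolding returning_def by blast
qed

text \<open>A block number congruent to \<open>s + 2\<close> modulo
  \<open>(s + 2) * (s' + 2)\<close> is a multiple of \<open>s + 2\<close> but not of the larger
  \<open>s' + 2\<close>; there one sequence runs through \<open>b\<close> and the other through
  \<open>a\<close>. Such blocks recur periodically, so the waiting time is bounded independently of
  \<open>t0\<close>.\<close>

lemma alternation_separated:
  assumes "s < s'" "t1 < L"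
  shows "\<exists>t. t0 \<le> t \<and> t \<le> t0 + (L * ((s + 2) * (s' + 2)) + (s + 3) * L) \<and>
    alternation L a b s t = b t1 \<and> alternation L a b s' t = a t1"
proof -
  define P where "P = (s + 2) * (s' + 2)"
  \<comment> \<open>\<open>L * P * q\<close> is the first multiple of \<open>L * P\<close> strictly
    beyond \<open>t0\<close>.\<close>
  define q where "q = Suc (t0 div (L * P))"
  define j where "j = q * P + (s + 2)"
  have LP: "L * P > 0" using assms by (simp add: P_def)
  have 1: "(L * P) * (t0 div (L * P)) \<le> t0" by simp
  have 2: "t0 < (L * P) * q" unfolding q_def using dividend_less_times_div[OF LP] by simp
  have t: "L * j + t1 = (L * P) * (t0 div (L * P)) + L * P + (s + 2) * L + t1"
    by (simp add: j_def q_def algebra_simps)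
  have "\<not> s' + 2 dvd j"
  proof
    assume "s' + 2 dvd j"
    then have "s' + 2 dvd s + 2"
      unfolding j_def P_def by (metis dvd_add_right_iff dvd_mult dvd_triv_right)
    then show False using assms(1) by (auto dest: dvd_imp_le)
  qed
  moreover have "s + 2 dvd j"
    unfolding j_def P_def by (intro dvd_add dvd_mult dvd_triv_left dvd_refl)
  ultimately have "alternation L a b s (L * j + t1) = b t1" "alternation L a b s' (L * j + t1) = a t1"
    using assms(2) by (simp_all add: alternation_def)
  moreover have "L * j + t1 \<le> t0 + (L * P + (s + 3) * L)"
    using t 1 assms(2) by (simp add: algebra_simps)
  moreover have "t0 \<le> L * j + t1"
    using 2 by (simp add: j_def algebra_simps)
  ultimately show ?thesis unfolding P_def by blast
qed

context compact_system
begin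

text \<open>If two points share the first and last visit times to a cell, then between these times a
  separation would produce two separated cycles. So the visit times determine a point of a
  separated set.\<close>

lemma separated_card_bound:
  assumes "\<sigma> > 0" "\<delta> > 0"
    and no: "\<And>u L a b t. cycle_at X f \<delta> u L a \<Longrightarrow> cycle_at X f \<delta> u L b \<Longrightarrow> t < L \<Longrightarrow>
      dist (a t) (b t) \<le> \<sigma>"
  shows "\<exists>k. \<forall>n E. finite E \<longrightarrow> separated_set X f n \<sigma> E \<longrightarrow> card E \<le> ((n + 1) * (n + 1)) ^ k"
proof -
  have "uniformly_continuous_on X f"
    using compact_uniformly_continuous[OF continuous compact] .
  then obtain \<eta>0 where \<eta>0: "\<eta>0 > 0" "\<And>p q. p \<in> X \<Longrightarrow> q \<in> X \<Longrightarrow> dist p q < \<eta>0 \<Longrightarrow> dist (f p) (f q) < \<delta> / 2"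
    unfolding uniformly_continuous_on_def using half_gt_zero[OF \<open>\<delta> > 0\<close>] by metis
  \<comment> \<open>The three bounds control, in order, the jump from a cell centre into an orbit,
    the jump back to the centre, and the distance of two points in one cell.\<close>
  define \<eta> where "\<eta> = min \<eta>0 (min (\<delta> / 2) (\<sigma> / 2))"
  have \<eta>: "\<eta> > 0" "\<eta> \<le> \<eta>0" "\<eta> \<le> \<delta> / 2" "\<eta> \<le> \<sigma> / 2"
    using \<eta>0(1) assms(1,2) by (auto simp: \<eta>_def)
  obtain K where K: "finite K" "K \<subseteq> X" "X \<subseteq> (\<Union>k\<in>K. ball k \<eta>)"
    using compactE_image[OF compact, of X "\<lambda>k. ball k \<eta>"] \<eta>(1) by force
  then have "\<forall>x\<in>X. \<exists>k\<in>K. dist k x < \<eta>" by fastforce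
  then obtain cell where cell: "\<And>x. x \<in> X \<Longrightarrow> cell x \<in> K" "\<And>x. x \<in> X \<Longrightarrow> dist (cell x) x < \<eta>"
    by metis
  define V where "V n x c = {i. i < n \<and> cell ((f ^^ i) x) = c}" for n x c
  \<comment> \<open>The pair \<open>(n, n)\<close> marks an unvisited cell; genuine visit times are
    below \<open>n\<close>.\<close>
  define code where "code n x = restrict (\<lambda>c. if V n x c = {} then (n, n) else (Min (V n x c), Max (V n x c))) K"
    for n x
  have finV: "finite (V n x c)" for n x c by (simp add: V_def)
  have near: "dist ((f ^^ t) x) ((f ^^ t) y) \<le> \<sigma>"
    if xy: "x \<in> X" "y \<in> X" and "code n x = code n y" and t: "t < n" for n x y t
  proof -
    define c where "c = cell ((f ^^ t) x)"
    have c: "c \<in> K" "c \<in> X" using cell(1) funpow_in[OF xy(1)] K(2) by (auto simp: c_def)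
    have tV: "t \<in> V n x c" using t by (simp add: V_def c_def)
    have code: "code n x c = (Min (V n x c), Max (V n x c))"
      using tV c(1) by (auto simp: code_def)
    define i j where "i = Min (V n x c)" and "j = Max (V n x c)"
    have x: "i \<in> V n x c" "j \<in> V n x c" "i \<le> t" "t \<le> j"
      using tV finV by (auto simp: i_def j_def intro!: Min_in Max_in)
    have "V n y c \<noteq> {}"
    proof
      assume "V n y c = {}"
      then have "code n y c = (n, n)" using c(1) by (simp add: code_def)
      then have "i = n" using code \<open>code n x = code n y\<close> by (simp add: i_def)
      with x(1) show False by (simp add: V_def)
    qed
    then have "code n y c = (Min (V n y c), Max (V n y c))"
      using c(1) by (simp add: code_def)
    then have "i = Min (V n y c)" "j = Max (V n y c)"
      using code \<open>code n x = code n y\<close> by (simp_all add: i_def j_def)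
    then have y: "i \<in> V n y c" "j \<in> V n y c"
      using \<open>V n y c \<noteq> {}\<close> finV by (metis Min_in, metis Max_in)
    have V: "dist c ((f ^^ l) z) < \<eta>" if "l \<in> V n z c" "z \<in> X" for l z
      using that(1) cell(2)[OF funpow_in[OF that(2)], of l] by (auto simp: V_def)
    have close: "dist c ((f ^^ i) z) < \<eta>" "dist c ((f ^^ j) z) < \<eta>" if "z = x \<or> z = y" for z
      using that x(1,2) y xy V by auto
    \<comment> \<open>At the first and last visit both points lie in the same cell. These times are
      settled separately because the cycles below carry the centre \<open>c\<close> at their ends
      instead of the orbit point.\<close>
    have both: "dist ((f ^^ l) x) ((f ^^ l) y) \<le> \<sigma>" if "l = i \<or> l = j" for l
    proof -
      have "dist c ((f ^^ l) x) < \<eta>" "dist c ((f ^^ l) y) < \<eta>" using close that by auto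
      then have "dist ((f ^^ l) x) ((f ^^ l) y) < 2 * \<eta>"
        using dist_triangle3[of "(f ^^ l) x" "(f ^^ l) y" c] by linarith
      then show ?thesis using \<eta>(4) by linarith
    qed
    show ?thesis
    proof (cases "t = i \<or> t = j")
      case False
      then have ij: "i < t" "t < j" using x(3,4) by auto
      define T where "T = j - i"
      have T: "0 < T" "j = T + i" "t - i < T" "0 < t - i" "t = (t - i) + i" using ij by (auto simp: T_def)
      \<comment> \<open>Each orbit segment between the two visits becomes a cycle through
        \<open>c\<close>; the lengths agree because the visit times do.\<close>
      have cyc: "\<exists>a. cycle_at X f \<delta> c T a \<and> a (t - i) = (f ^^ t) z" if z: "z = x \<or> z = y" for z
      proof -
        have zX: "(f ^^ i) z \<in> X" using z xy funpow_in by auto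
        have "dist (f c) (f ((f ^^ i) z)) \<le> \<delta> / 2"
          using \<eta>0(2)[OF c(2) zX] close(1)[OF z] \<eta>(2) by (simp add: less_imp_le)
        moreover have "dist ((f ^^ T) ((f ^^ i) z)) c \<le> \<delta> / 2"
          using close(2)[OF z] \<eta>(3) T(2) by (simp add: funpow_add dist_commute)
        ultimately obtain a where a: "cycle_at X f \<delta> c T a"
          "\<And>l. l < T \<Longrightarrow> a l = (if l = 0 then c else (f ^^ l) ((f ^^ i) z))"
          using cycle_through_orbit[OF c(2) zX T(1)] by blast
        have "a (t - i) = (f ^^ (t - i)) ((f ^^ i) z)" using a(2)[OF T(3)] T(4) by simp
        also have "\<dots> = (f ^^ t) z" using ij funpow_add_apply[of "t - i" i z] by simp
        finally show ?thesis using a(1) by blast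
      qed
      then show ?thesis using no[OF _ _ T(3)] by metis
    qed (use both in auto)
  qed
  have "card E \<le> ((n + 1) * (n + 1)) ^ card K" if E: "finite E" "separated_set X f n \<sigma> E" for n E
  proof -
    have "inj_on (code n) E"
    proof (rule inj_onI, rule ccontr)
      fix x y assume *: "x \<in> E" "y \<in> E" "code n x = code n y" "x \<noteq> y"
      then obtain t where "t < n" "dist ((f ^^ t) x) ((f ^^ t) y) > \<sigma>"
        using E(2) unfolding separated_set_def by blast
      moreover have "x \<in> X" "y \<in> X" using * E(2) by (auto simp: separated_set_def)
      ultimately show False using near[of x y n t] * by simp
    qed
    moreover have "code n ` E \<subseteq> K \<rightarrow>\<^sub>E {..n} \<times> {..n}"
    proof -
      have "Min (V n x c) \<le> n" "Max (V n x c) \<le> n" if "V n x c \<noteq> {}" for x c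
        using Min_in[OF finV that] Max_in[OF finV that] by (auto simp: V_def)
      then show ?thesis by (auto simp: code_def)
    qed
    moreover have "finite (K \<rightarrow>\<^sub>E {..n} \<times> {..n})"
      using K(1) by (intro finite_PiE) auto
    ultimately have "card E \<le> card (K \<rightarrow>\<^sub>E {..n} \<times> {..n})"
      using card_inj_on_le by blast
    also have "\<dots> = ((n + 1) * (n + 1)) ^ card K"
      using K(1) by (simp add: card_PiE card_cartesian_product)
    finally show ?thesis .
  qed
  then show ?thesis by blast
qed

text \<open>Otherwise separated sets have polynomial size, and the logarithm of a polynomial divided
  by \<open>n\<close> tends to 0, against positive entropy.\<close>

lemma separated_cycles:
  assumes "\<sigma> > 0" "\<delta> > 0" "entropy_at_scale X f \<sigma> > 0"
  shows "\<exists>u L a b t. cycle_at X f \<delta> u L a \<and> cycle_at X f \<delta> u L b \<and> t < L \<and> dist (a t) (b t) > \<sigma>"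
proof (rule ccontr)
  assume no: "\<not> ?thesis"
  obtain k where k: "\<And>n E. finite E \<Longrightarrow> separated_set X f n \<sigma> E \<Longrightarrow> card E \<le> ((n + 1) * (n + 1)) ^ k"
  proof -
    have "dist (a t) (b t) \<le> \<sigma>"
      if "cycle_at X f \<delta> u L a" "cycle_at X f \<delta> u L b" "t < L" for u L a b t
      using no that by (meson not_less)
    then show ?thesis using that separated_card_bound[OF assms(1,2)] by blast
  qed
  have "ln (max_separated X f n \<sigma>) / real n \<le> 2 * real k * (ln (real n + 1) / real n)" for n
  proof -
    let ?A = "{real (card E) | E. finite E \<and> separated_set X f n \<sigma> E}"
    let ?B = "((real n + 1) * (real n + 1)) ^ k"
    have "separated_set X f n \<sigma> {}" by (simp add: separated_set_def)
    then have A0: "0 \<in> ?A" by (intro CollectI exI[of _ "{}"]) simp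
    have AB: "y \<le> ?B" if y: "y \<in> ?A" for y
    proof -
      obtain E where E: "y = real (card E)" "finite E" "separated_set X f n \<sigma> E" using y by blast
      have "real (card E) \<le> real (((n + 1) * (n + 1)) ^ k)"
        using k[OF E(2,3)] by (simp only: of_nat_le_iff)
      also have "\<dots> = ?B" by (simp only: of_nat_power of_nat_mult of_nat_add of_nat_1)
      finally show ?thesis using E(1) by simp
    qed
    have "bdd_above ?A" using AB by (rule bdd_aboveI)
    then have "0 \<le> max_separated X f n \<sigma>"
      unfolding max_separated_def using A0 by (intro cSup_upper)
    moreover have "max_separated X f n \<sigma> \<le> ?B"
      unfolding max_separated_def using A0 AB by (intro cSup_least) auto
    \<comment> \<open>Covers the value 0 of \<open>max_separated\<close>, where
      \<open>ln 0 = 0\<close> by convention.\<close>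
    moreover have "1 \<le> ?B" by (intro one_le_power) (simp add: algebra_simps)
    ultimately have "ln (max_separated X f n \<sigma>) \<le> ln ?B"
      by (cases "max_separated X f n \<sigma> = 0") auto
    also have "\<dots> = 2 * real k * ln (real n + 1)"
      by (simp add: ln_realpow ln_mult)
    finally show ?thesis by (simp add: divide_right_mono)
  qed
  then have le: "entropy_at_scale X f \<sigma> \<le> limsup (\<lambda>n. ereal (2 * real k * (ln (real n + 1) / real n)))"
    unfolding entropy_at_scale_def by (intro Limsup_mono) simp
  have "limsup (\<lambda>n. ereal (2 * real k * (ln (real n + 1) / real n))) = 0"
  proof -
    have "(\<lambda>n. ln (real n + 1) / real n) \<longlonglongrightarrow> 0" by real_asymp
    then have "(\<lambda>n. 2 * real k * (ln (real n + 1) / real n)) \<longlonglongrightarrow> 2 * real k * 0"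
      by (intro tendsto_intros)
    then have "(\<lambda>n. ereal (2 * real k * (ln (real n + 1) / real n))) \<longlonglongrightarrow> 0"
      by (simp add: zero_ereal_def)
    then show ?thesis by (rule lim_imp_Limsup[OF sequentially_bot])
  qed
  with le assms(3) show False by simp
qed

end

section \<open>The stages of the construction\<close>

text \<open>Each lift prepends a new initial piece, so the point that is being constructed sits at index
  \<open>origin\<close> of a history rather than at index 0; \<open>horizon\<close> is the time, counted from the
  origin, up to which later stages only perturb the history. \<open>symbol s\<close> is the current lift of the
  fixed sequence \<open>y s\<close>, which it follows from index \<open>offset s\<close> on.\<close>

record 'a stage =
  base :: 'a
  period :: nat
  symbol :: "nat \<Rightarrow> nat \<Rightarrow> 'a"
  offset :: "nat \<Rightarrow> nat"
  hist :: "bool list \<Rightarrow> nat \<Rightarrow> 'a"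
  origin :: nat
  horizon :: nat

text \<open>\<open>\<phi> k c\<close> is the index of the sequence that the word \<open>c\<close>
  follows at stage \<open>k\<close>. It is left open here and later instantiated by
  \<open>label\<close>.\<close>

locale scrambling = compact_system X f for X :: "'a::metric_space set" and f +
  fixes d \<epsilon> :: "nat \<Rightarrow> real" and y :: "nat \<Rightarrow> nat \<Rightarrow> 'a" and \<phi> :: "nat \<Rightarrow> bool list \<Rightarrow> nat"
  assumes d_pos: "d k > 0"
    and shadow: "pseudo_orbit X f (d k) \<rho> \<Longrightarrow> \<exists>x\<in>X. \<forall>t. dist ((f ^^ t) x) (\<rho> t) \<le> \<epsilon> k"
begin

definition stage_ok :: "nat \<Rightarrow> 'a stage \<Rightarrow> bool" where
  "stage_ok k st \<longleftrightarrow> period st > 0 \<and> (\<exists>\<zeta>. cycle_at X f (d k) (base st) (period st) \<zeta>) \<and>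
     (\<forall>s. returning X f (d k) (base st) (period st) (symbol st s) \<and> period st dvd offset st s \<and>
       (\<forall>t. dist (symbol st s (offset st s + t)) (y s t) \<le> (\<Sum>j<k. \<epsilon> j))) \<and>
     (\<forall>c. returning X f (d k) (base st) (period st) (hist st c))"

text \<open>\<open>k * p \<le> m\<close> says that a phase of length \<open>m\<close> outweighs the
  time \<open>p\<close> before it by the factor \<open>k\<close>; this yields upper density one.
  Both phases end before the new horizon, so later stages only perturb them.\<close>

definition stage_step :: "nat \<Rightarrow> 'a stage \<Rightarrow> 'a stage \<Rightarrow> bool" where
  "stage_step k st st' \<longleftrightarrow> horizon st \<le> horizon st' \<and>
     (\<forall>c t. length c = Suc k \<longrightarrow> t \<le> horizon st \<longrightarrow>
       dist (hist st' c (origin st' + t)) (hist st (take k c) (origin st + t)) \<le> \<epsilon> k) \<and>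
     (\<exists>p m. p + m \<le> horizon st' \<and> k * p \<le> m \<and> k \<le> m \<and>
       (\<forall>c t. length c = Suc k \<longrightarrow> t < m \<longrightarrow>
         dist (hist st' c (origin st' + (p + t))) (y (\<phi> k c) t) \<le> (\<Sum>j<Suc k. \<epsilon> j))) \<and>
     (\<exists>p m. p + m \<le> horizon st' \<and> k * p \<le> m \<and> k \<le> m \<and>
       (\<forall>c c' t. length c = Suc k \<longrightarrow> length c' = Suc k \<longrightarrow> t < m \<longrightarrow>
         dist (hist st' c (origin st' + (p + t))) (hist st' c' (origin st' + (p + t))) \<le> 2 * \<epsilon> k))"

text \<open>The jump size is unchanged. The old history is closed at \<open>A\<close>, the symbol
  reaches its offset after \<open>R\<close> further steps, the whole symbol part is closed after
  \<open>B\<close> steps, and then all words run through \<open>symbol st 0\<close>. These lengths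
  are common to all words, so the phases are simultaneous.\<close>

lemma stage_extend:
  assumes ok: "stage_ok k st"
  shows "\<exists>H A B R m m'.
    (\<forall>c. returning X f (d k) (base st) (period st) (H c)) \<and>
    origin st + horizon st < A \<and> R \<le> B \<and>
    (\<forall>c i. length c = Suc k \<longrightarrow> i \<le> origin st + horizon st \<longrightarrow> H c i = hist st (take k c) i) \<and>
    k * (A + R) \<le> m \<and> k \<le> m \<and> R + m \<le> B \<and>
    (\<forall>c t. length c = Suc k \<longrightarrow> t < m \<longrightarrow>
      H c (A + R + t) = symbol st (\<phi> k c) (offset st (\<phi> k c) + t)) \<and>
    k * (A + B) \<le> m' \<and> k \<le> m' \<and>
    (\<forall>c t. length c = Suc k \<longrightarrow> H c (A + B + t) = symbol st 0 t)"
proof -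
  define C where "C = {c :: bool list. length c = Suc k}"
  have C: "finite C" unfolding C_def using finite_lists_length_eq[of "UNIV :: bool set"] by simp
  let ?u = "base st" and ?N = "period st" and ?E = "origin st + horizon st"
  obtain \<kappa> where N: "?N > 0" and cyc: "cycle_at X f (d k) ?u ?N \<kappa>"
    using ok by (auto simp: stage_ok_def)
  have symbol: "returning X f (d k) ?u ?N (symbol st s)" "?N dvd offset st s" for s
    using ok by (auto simp: stage_ok_def)
  have hist: "returning X f (d k) ?u ?N (hist st c)" for c
    using ok by (auto simp: stage_ok_def)
  have "\<exists>M. \<forall>T\<ge>M. ?N dvd T \<longrightarrow>
      (\<forall>c\<in>C. \<exists>\<theta>. cycle_at X f (d k) ?u T \<theta> \<and> (\<forall>j\<le>?E. \<theta> j = hist st (take k c) j))"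
    by (rule returning_closes_finite[OF cyc C hist])
  then obtain M where M: "\<And>T c. T \<ge> M \<Longrightarrow> ?N dvd T \<Longrightarrow> c \<in> C \<Longrightarrow>
      \<exists>\<theta>. cycle_at X f (d k) ?u T \<theta> \<and> (\<forall>j\<le>?E. \<theta> j = hist st (take k c) j)"
    by auto
  define A where "A = ?N * (M + ?E + 1)"
  have "1 * (M + ?E + 1) \<le> A" unfolding A_def using N by (intro mult_le_mono1) simp
  then have A: "M \<le> A" "?E < A" "?N dvd A" by (auto simp: A_def)
  obtain \<theta>1 where \<theta>1: "\<And>c. c \<in> C \<Longrightarrow> cycle_at X f (d k) ?u A (\<theta>1 c)"
      "\<And>c j. c \<in> C \<Longrightarrow> j \<le> ?E \<Longrightarrow> \<theta>1 c j = hist st (take k c) j"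
    using M[OF A(1,3)] by metis
  \<comment> \<open>The sum is at least every single offset and inherits divisibility by the period;
    padding moves all offsets to this index.\<close>
  define R where "R = (\<Sum>c\<in>C. offset st (\<phi> k c))"
  have R: "offset st (\<phi> k c) \<le> R" if "c \<in> C" for c
    unfolding R_def using that C by (intro member_le_sum) auto
  have "?N dvd R" unfolding R_def using symbol(2) by (intro dvd_sum)
  have "\<exists>\<eta>. returning X f (d k) ?u ?N \<eta> \<and>
      (\<forall>t. \<eta> (R - offset st (\<phi> k c) + t) = symbol st (\<phi> k c) t)" for c
    using \<open>?N dvd R\<close> symbol(2) by (intro returning_pad[OF cyc symbol(1)] dvd_diff_nat)
  then obtain \<eta> where \<eta>: "\<And>c. returning X f (d k) ?u ?N (\<eta> c)"
      "\<And>c t. \<eta> c (R - offset st (\<phi> k c) + t) = symbol st (\<phi> k c) t"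
    by metis
  have \<eta>R: "\<eta> c (R + t) = symbol st (\<phi> k c) (offset st (\<phi> k c) + t)" if "c \<in> C" for c t
    using \<eta>(2)[of c "offset st (\<phi> k c) + t"] R[OF that] by simp
  \<comment> \<open>\<open>A + R\<close> counts from index 0, so it bounds the start of the phase as
    counted from the origin.\<close>
  define m where "m = k * (A + R) + k"
  have "\<exists>M. \<forall>T\<ge>M. ?N dvd T \<longrightarrow>
      (\<forall>c\<in>C. \<exists>\<theta>. cycle_at X f (d k) ?u T \<theta> \<and> (\<forall>j\<le>R + m. \<theta> j = \<eta> c j))"
    by (rule returning_closes_finite[OF cyc C \<eta>(1)])
  then obtain M' where M': "\<And>T c. T \<ge> M' \<Longrightarrow> ?N dvd T \<Longrightarrow> c \<in> C \<Longrightarrow>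
      \<exists>\<theta>. cycle_at X f (d k) ?u T \<theta> \<and> (\<forall>j\<le>R + m. \<theta> j = \<eta> c j)"
    by auto
  define B where "B = ?N * (M' + R + m + 1)"
  have "1 * (M' + R + m + 1) \<le> B" unfolding B_def using N by (intro mult_le_mono1) simp
  then have B: "M' \<le> B" "R + m < B" "?N dvd B" by (auto simp: B_def)
  obtain \<theta>2 where \<theta>2: "\<And>c. c \<in> C \<Longrightarrow> cycle_at X f (d k) ?u B (\<theta>2 c)"
      "\<And>c j. c \<in> C \<Longrightarrow> j \<le> R + m \<Longrightarrow> \<theta>2 c j = \<eta> c j"
    using M'[OF B(1,3)] by metis
  \<comment> \<open>Words of other lengths get a default value that is still returning.\<close>
  define H where "H c = (if c \<in> C then switch_at (\<theta>1 c) A (switch_at (\<theta>2 c) B (symbol st 0)) else symbol st 0)"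
    for c
  have "returning X f (d k) ?u ?N (H c)" for c
    using \<theta>1(1) \<theta>2(1) A(3) B(3) symbol(1) by (simp add: H_def returning_switch_at)
  moreover have "H c i = hist st (take k c) i" if "c \<in> C" "i \<le> ?E" for c i
    using that A(2) \<theta>1(2) by (simp add: H_def switch_at_before)
  moreover have "H c (A + R + t) = symbol st (\<phi> k c) (offset st (\<phi> k c) + t)" if "c \<in> C" "t < m" for c t
    using that B(2) \<theta>2(2)[of c "R + t"] \<eta>R by (simp add: H_def switch_at_before add.assoc)
  moreover have "H c (A + B + t) = symbol st 0 t" if "c \<in> C" for c t
    using that by (simp add: H_def add.assoc)
  moreover have "k * (A + R) \<le> m" "k \<le> m" "R \<le> B" "R + m \<le> B"
    using B(2) by (auto simp: m_def)
  \<comment> \<open>The common phase never ends in \<open>H\<close>, so its length can be prescribed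
    freely.\<close>
  moreover have "k * (A + B) \<le> k * (A + B) + k" "k \<le> k * (A + B) + k" by simp_all
  ultimately show ?thesis
    using A(2) unfolding C_def mem_Collect_eq
    by (intro exI[of _ H] exI[of _ A] exI[of _ B] exI[of _ R] exI[of _ m]
        exI[of _ "k * (A + B) + k"]) simp
qed

text \<open>Symbols and extended histories are lifted together, as one family over a sum type, so
  that they share the new base point and period.\<close>

lemma stage_successor:
  assumes ok: "stage_ok k st"
  shows "\<exists>st'. stage_ok (Suc k) st' \<and> stage_step k st st'"
proof -
  define C where "C = {c :: bool list. length c = Suc k}"
  have C: "finite C" unfolding C_def using finite_lists_length_eq[of "UNIV :: bool set"] by simp
  let ?u = "base st" and ?N = "period st" and ?E = "origin st + horizon st"
  obtain \<kappa> where N: "?N > 0" and cyc: "cycle_at X f (d k) ?u ?N \<kappa>"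
    using ok by (auto simp: stage_ok_def)
  have symbol: "returning X f (d k) ?u ?N (symbol st s)" "?N dvd offset st s"
      "dist (symbol st s (offset st s + t)) (y s t) \<le> (\<Sum>j<k. \<epsilon> j)" for s t
    using ok by (auto simp: stage_ok_def)
  obtain H A B R m m' where H: "\<And>c. returning X f (d k) ?u ?N (H c)"
    and A: "?E < A" and R: "R \<le> B"
    and Hhist: "\<And>c i. length c = Suc k \<Longrightarrow> i \<le> ?E \<Longrightarrow> H c i = hist st (take k c) i"
    and m: "k * (A + R) \<le> m" "k \<le> m" "R + m \<le> B"
    and Hpath: "\<And>c t. length c = Suc k \<Longrightarrow> t < m \<Longrightarrow>
      H c (A + R + t) = symbol st (\<phi> k c) (offset st (\<phi> k c) + t)"
    and m': "k * (A + B) \<le> m'" "k \<le> m'"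
    and Hcommon: "\<And>c t. length c = Suc k \<Longrightarrow> H c (A + B + t) = symbol st 0 t"
    using stage_extend[OF ok] by (elim exE conjE) blast
  define \<xi> :: "nat + bool list \<Rightarrow> nat \<Rightarrow> 'a" where "\<xi> = case_sum (symbol st) H"
  define r :: "nat + bool list \<Rightarrow> nat" where "r = case_sum (offset st) (\<lambda>_. 0)"
  have \<xi>: "returning X f (d k) ?u ?N (\<xi> s)" for s
    using symbol(1) H by (cases s) (simp_all add: \<xi>_def)
  have r: "?N dvd r s" for s
    using symbol(2) by (cases s) (simp_all add: r_def)
  have "\<exists>u' N' \<zeta> \<xi>' R. N' > 0 \<and> cycle_at X f (d (Suc k)) u' N' \<zeta> \<and>
    (\<forall>s. returning X f (d (Suc k)) u' N' (\<xi>' s) \<and> N' dvd R s + r s \<and>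
      (\<forall>t. dist (\<xi>' s (R s + t)) (\<xi> s t) \<le> \<epsilon> k))"
    using shadow N cyc \<xi> r d_pos by (rule lift_returning)
  then obtain u' N' \<zeta> \<xi>' R' where N': "N' > 0" and \<zeta>: "cycle_at X f (d (Suc k)) u' N' \<zeta>"
    and \<xi>': "\<And>s. returning X f (d (Suc k)) u' N' (\<xi>' s)" and R': "\<And>s. N' dvd R' s + r s"
    and track: "\<And>s t. dist (\<xi>' s (R' s + t)) (\<xi> s t) \<le> \<epsilon> k"
    by (elim exE conjE) blast
  \<comment> \<open>The lifted histories come with different shifts; padding moves them to the
    common shift \<open>Q\<close>, so one origin serves all words of length
    \<open>Suc k\<close>.\<close>
  define Q where "Q = (\<Sum>c\<in>C. R' (Inr c))"
  have NR: "N' dvd R' (Inr c)" for c using R'[of "Inr c"] by (simp add: r_def)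
  have Q: "R' (Inr c) \<le> Q" if "c \<in> C" for c
    unfolding Q_def using that C by (intro member_le_sum) auto
  have "N' dvd Q" unfolding Q_def using NR by (intro dvd_sum)
  have "\<exists>\<eta>. returning X f (d (Suc k)) u' N' \<eta> \<and> (\<forall>t. \<eta> (Q - R' (Inr c) + t) = \<xi>' (Inr c) t)" for c
    using \<open>N' dvd Q\<close> NR by (intro returning_pad[OF \<zeta> \<xi>'] dvd_diff_nat)
  then obtain \<eta> where \<eta>: "\<And>c. returning X f (d (Suc k)) u' N' (\<eta> c)"
      "\<And>c t. \<eta> c (Q - R' (Inr c) + t) = \<xi>' (Inr c) t"
    by metis
  have \<eta>H: "dist (\<eta> c (Q + i)) (H c i) \<le> \<epsilon> k" if "length c = Suc k" for c i
  proof -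
    have "\<eta> c (Q + i) = \<xi>' (Inr c) (R' (Inr c) + i)"
      using \<eta>(2)[of c "R' (Inr c) + i"] Q[of c] that by (simp add: C_def)
    then show ?thesis using track[of "Inr c" i] by (simp add: \<xi>_def)
  qed
  define st' where "st' = \<lparr>base = u', period = N', symbol = (\<lambda>s. \<xi>' (Inl s)),
    offset = (\<lambda>s. R' (Inl s) + offset st s), hist = \<eta>, origin = Q + origin st,
    horizon = A + B + m' - origin st\<rparr>"
  have "dist (\<xi>' (Inl s) (R' (Inl s) + offset st s + t)) (y s t) \<le> (\<Sum>j<Suc k. \<epsilon> j)" for s t
    using track[of "Inl s" "offset st s + t"] symbol(3)[of s t]
      dist_triangle[of "\<xi>' (Inl s) (R' (Inl s) + offset st s + t)" "y s t" "symbol st s (offset st s + t)"]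
    by (simp add: \<xi>_def add.assoc)
  moreover have "N' dvd R' (Inl s) + offset st s" for s
    using R'[of "Inl s"] by (simp add: r_def)
  ultimately have "stage_ok (Suc k) st'"
    unfolding stage_ok_def st'_def using N' \<zeta> \<xi>' \<eta>(1) by auto
  moreover have "stage_step k st st'"
    unfolding stage_step_def
  proof (intro conjI allI impI)
    show "horizon st \<le> horizon st'" using A by (simp add: st'_def)
  next
    fix c :: "bool list" and t assume "length c = Suc k" "t \<le> horizon st"
    then show "dist (hist st' c (origin st' + t)) (hist st (take k c) (origin st + t)) \<le> \<epsilon> k"
      using \<eta>H[of c "origin st + t"] Hhist[of c "origin st + t"] by (simp add: st'_def add.assoc)
  next
    let ?p = "A + R - origin st"
    have p: "origin st' + (?p + t) = Q + (A + R + t)" for t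
      using A by (simp add: st'_def)
    have "dist (hist st' c (origin st' + (?p + t))) (y (\<phi> k c) t) \<le> (\<Sum>j<Suc k. \<epsilon> j)"
      if "length c = Suc k" "t < m" for c t
    proof -
      let ?z = "symbol st (\<phi> k c) (offset st (\<phi> k c) + t)"
      have "dist (\<eta> c (Q + (A + R + t))) ?z \<le> \<epsilon> k"
        using \<eta>H[OF that(1), of "A + R + t"] Hpath[OF that] by simp
      moreover have "dist ?z (y (\<phi> k c) t) \<le> (\<Sum>j<k. \<epsilon> j)" by (rule symbol(3))
      moreover have "hist st' = \<eta>" by (simp add: st'_def)
      ultimately show ?thesis
        using dist_triangle[of "\<eta> c (Q + (A + R + t))" "y (\<phi> k c) t" ?z] unfolding p by simp
    qed
    moreover have "k * ?p \<le> m" using m(1) by (meson diff_le_self mult_le_mono2 order_trans)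
    moreover have "?p + m \<le> horizon st'" using m(3) A by (simp add: st'_def)
    ultimately show "\<exists>p m. p + m \<le> horizon st' \<and> k * p \<le> m \<and> k \<le> m \<and>
       (\<forall>c t. length c = Suc k \<longrightarrow> t < m \<longrightarrow>
         dist (hist st' c (origin st' + (p + t))) (y (\<phi> k c) t) \<le> (\<Sum>j<Suc k. \<epsilon> j))"
      using m(2) by blast
  next
    let ?p = "A + B - origin st"
    have p: "origin st' + (?p + t) = Q + (A + B + t)" for t
      using A by (simp add: st'_def)
    have "dist (hist st' c (origin st' + (?p + t))) (hist st' c' (origin st' + (?p + t))) \<le> 2 * \<epsilon> k"
      if "length c = Suc k" "length c' = Suc k" for c c' t
    proof -
      have "dist (\<eta> c (Q + (A + B + t))) (symbol st 0 t) \<le> \<epsilon> k"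
        "dist (\<eta> c' (Q + (A + B + t))) (symbol st 0 t) \<le> \<epsilon> k"
        using \<eta>H[of _ "A + B + t"] Hcommon that by metis+
      moreover have "hist st' = \<eta>" by (simp add: st'_def)
      ultimately show ?thesis
        using dist_triangle2[of "\<eta> c (Q + (A + B + t))" "\<eta> c' (Q + (A + B + t))" "symbol st 0 t"]
        unfolding p by simp
    qed
    moreover have "k * ?p \<le> m'" using m'(1) by (meson diff_le_self mult_le_mono2 order_trans)
    moreover have "?p + m' \<le> horizon st'" using A by (simp add: st'_def)
    ultimately show "\<exists>p m. p + m \<le> horizon st' \<and> k * p \<le> m \<and> k \<le> m \<and>
       (\<forall>c c' t. length c = Suc k \<longrightarrow> length c' = Suc k \<longrightarrow> t < m \<longrightarrow>
         dist (hist st' c (origin st' + (p + t))) (hist st' c' (origin st' + (p + t))) \<le> 2 * \<epsilon> k)"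
      using m'(2) by blast
  qed
  ultimately show ?thesis by blast
qed

lemma stage_sequence:
  assumes "L > 0" "cycle_at X f (d 0) u L \<zeta>" "\<And>s. returning X f (d 0) u L (y s)"
  obtains st where "\<And>k. stage_ok k (st k)" "\<And>k. stage_step k (st k) (st (Suc k))"
proof -
  define st0 where "st0 = \<lparr>base = u, period = L, symbol = y, offset = (\<lambda>_. 0), hist = (\<lambda>_. y 0),
    origin = 0, horizon = 0\<rparr>"
  have "stage_ok 0 st0"
    using assms by (auto simp: stage_ok_def st0_def)
  then obtain st where "\<And>k. stage_ok k (st k) \<and> stage_step k (st k) (st (Suc k))"
    using dependent_nat_choice[of stage_ok stage_step] stage_successor by metis
  then show ?thesis using that by metis
qed

end

section \<open>Upper density and Cantor sets\<close>

text \<open>At time \<open>p + m\<close> at least \<open>m - W\<close> good times have occurred, so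
  the bad proportion is at most \<open>(W + 1) / K\<close>. The loss of \<open>W\<close> allows for
  properties that look ahead in a window of that length.\<close>

lemma upper_density_oneI:
  assumes "\<And>K. \<exists>p m. K * p \<le> m \<and> K \<le> m \<and> (\<forall>t. t + W < m \<longrightarrow> P (p + t))"
  shows "upper_density_one P"
proof -
  define D where "D m = ereal (real (card {k. k < m \<and> P k}) / real m)" for m
  have "card {k. k < m \<and> P k} \<le> m" for m
    using card_mono[of "{..<m}" "{k. k < m \<and> P k}"] by auto
  then have "D m \<le> 1" for m
    unfolding D_def one_ereal_def by (simp add: divide_le_eq)
  then have "limsup D \<le> limsup (\<lambda>_. 1)" by (intro Limsup_mono) simp
  then have "limsup D \<le> 1" by (simp add: Limsup_const)
  moreover have "1 \<le> (SUP m\<in>{n..}. D m)" for n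
  proof (rule LIMSEQ_le_const2)
    have "(\<lambda>K. 1 - real (W + 1) / real K) \<longlonglongrightarrow> 1 - 0"
      by (intro tendsto_intros lim_const_over_n)
    then show "(\<lambda>K. ereal (1 - real (W + 1) / real K)) \<longlonglongrightarrow> 1"
      by (simp add: one_ereal_def)
    have "ereal (1 - real (W + 1) / real K) \<le> (SUP m\<in>{n..}. D m)" if K: "K \<ge> n + 1" for K
    proof -
      obtain p m where m: "K * p \<le> m" "K \<le> m" and P: "\<And>t. t + W < m \<Longrightarrow> P (p + t)"
        using assms[of K] by blast
      have "(\<lambda>t. p + t) ` {..<m - W} \<subseteq> {k. k < p + m \<and> P k}"
        using P by (auto simp: less_diff_conv)
      then have "card ((\<lambda>t. p + t) ` {..<m - W}) \<le> card {k. k < p + m \<and> P k}"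
        by (intro card_mono) auto
      then have card: "m - W \<le> card {k. k < p + m \<and> P k}"
        by (simp add: card_image)
      have K0: "real K > 0" and pm: "real (p + m) > 0" using K m(2) by auto
      have "real K * real p \<le> real m" using m(1) by (metis of_nat_le_iff of_nat_mult)
      moreover have "real W * real K \<le> real W * real (p + m)" using m(2) by (intro mult_left_mono) auto
      moreover have "real p \<ge> 0" by simp
      ultimately have "real K * (real p + real W) \<le> real (W + 1) * real (p + m)"
        by (simp add: algebra_simps)
      then have "(real p + real W) / real (p + m) \<le> real (W + 1) / real K"
        using K0 pm by (simp add: field_simps)
      moreover have "1 - (real p + real W) / real (p + m) = (real m - real W) / real (p + m)"
        using pm by (simp add: field_simps)
      moreover have "real m - real W \<le> real (card {k. k < p + m \<and> P k})"
        using card by linarith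
      then have "(real m - real W) / real (p + m) \<le> real (card {k. k < p + m \<and> P k}) / real (p + m)"
        by (intro divide_right_mono) auto
      ultimately have "1 - real (W + 1) / real K \<le> real (card {k. k < p + m \<and> P k}) / real (p + m)"
        by linarith
      then have "ereal (1 - real (W + 1) / real K) \<le> D (p + m)" by (simp add: D_def)
      also have "\<dots> \<le> (SUP m\<in>{n..}. D m)" using m(2) K by (intro SUP_upper) simp
      finally show ?thesis .
    qed
    then show "\<exists>N. \<forall>K\<ge>N. ereal (1 - real (W + 1) / real K) \<le> (SUP m\<in>{n..}. D m)" by blast
  qed
  then have "1 \<le> limsup D"
    unfolding limsup_INF_SUP by (intro INF_greatest)
  ultimately show ?thesis
    unfolding upper_density_one_def D_def by (rule order.antisym)
qed

section \<open>Cantor sets as continuous injective images of the binary sequences\<close>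

lemma compact_bool_sequences: "compact (UNIV :: (nat \<Rightarrow> bool) set)"
proof -
  have "compact_space (product_topology (\<lambda>_::nat. euclidean :: bool topology) UNIV)"
    unfolding compact_space_product_topology by (simp add: compact_space_def finite_imp_compact)
  then show ?thesis
    by (simp add: euclidean_product_topology compact_space_def)
qed

lemma continuous_on_bool_sequences:
  fixes F :: "(nat \<Rightarrow> bool) \<Rightarrow> 'b::metric_space"
  assumes "\<And>e. e > 0 \<Longrightarrow> \<exists>k. \<forall>c c'. (\<forall>i<k. c i = c' i) \<longrightarrow> dist (F c) (F c') < e"
  shows "continuous_on UNIV F"
  unfolding continuous_on_topological
proof (intro ballI allI impI)
  fix c B assume "open B" "F c \<in> B"
  then obtain e where e: "e > 0" "ball (F c) e \<subseteq> B" using open_contains_ball by blast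
  obtain k where k: "\<And>c'. (\<forall>i<k. c i = c' i) \<Longrightarrow> dist (F c) (F c') < e" using assms[OF e(1)] by blast
  let ?A = "\<Inter>i\<in>{..<k}. (\<lambda>c'. c' i) -` {c i}"
  have "open ?A"
    by (intro open_INT ballI open_vimage open_discrete continuous_on_product_coordinates) simp
  moreover have "c \<in> ?A" by simp
  moreover have "F c' \<in> B" if "c' \<in> ?A" for c'
    using that k[of c'] e(2) by auto
  ultimately show "\<exists>A. open A \<and> c \<in> A \<and> (\<forall>c'\<in>UNIV. c' \<in> A \<longrightarrow> F c' \<in> B)" by blast
qed

definition ternary :: "(nat \<Rightarrow> bool) \<Rightarrow> real" where
  "ternary c = (\<Sum>n. (if c n then 2 else 0) / 3 ^ Suc n)"

lemma ternary_sums: "(\<lambda>n. (if c n then 2 else 0) / 3 ^ Suc n :: real) sums ternary c"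
proof -
  have "summable (\<lambda>n. 2 / 3 * (1 / 3) ^ n :: real)" by (intro summable_mult summable_geometric) simp
  then have "summable (\<lambda>n. (if c n then 2 else 0) / 3 ^ Suc n :: real)"
    by (rule summable_comparison_test_ev[rotated]) (simp add: power_divide)
  then show ?thesis unfolding ternary_def by (rule summable_sums)
qed

lemma ternary_bounds: "0 \<le> ternary c" "ternary c \<le> 1"
proof -
  have "(\<lambda>n. 2 / 3 * (1 / 3) ^ n :: real) sums (2 / 3 * (1 / (1 - 1 / 3)))"
    by (intro sums_mult geometric_sums) simp
  then have "(\<lambda>n. 2 / 3 * (1 / 3) ^ n :: real) sums 1" by simp
  from sums_le[OF _ ternary_sums this] show "ternary c \<le> 1"
    by (simp add: power_divide)
  show "0 \<le> ternary c" using sums_le[OF _ sums_zero ternary_sums[of c]] by simp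
qed

text \<open>Self-similarity of the middle-third set; injectivity and the modulus of continuity
  follow by induction on digits.\<close>

lemma ternary_Suc: "ternary c = (if c 0 then 2 else 0) / 3 + ternary (\<lambda>n. c (Suc n)) / 3"
proof -
  have "(\<lambda>n. (if c (Suc n) then 2 else 0) / 3 ^ Suc n / 3 :: real) sums (ternary (\<lambda>n. c (Suc n)) / 3)"
    by (intro sums_divide ternary_sums)
  then have "(\<lambda>n. (if c (Suc n) then 2 else 0) / 3 ^ Suc (Suc n) :: real) sums (ternary (\<lambda>n. c (Suc n)) / 3)"
    by (simp add: field_simps)
  from sums_Suc[OF this] show ?thesis
    using sums_unique2[OF ternary_sums[of c]] by (simp add: add.commute)
qed

lemma inj_ternary: "inj ternary"
proof (rule injI, rule ext)
  fix c c' k assume "ternary c = ternary c'"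
  then show "c k = c' k"
  proof (induction k arbitrary: c c')
    case 0
    then show ?case
      using ternary_Suc[of c] ternary_Suc[of c'] ternary_bounds[of "\<lambda>n. c (Suc n)"]
        ternary_bounds[of "\<lambda>n. c' (Suc n)"] by (auto split: if_splits)
  next
    case (Suc k)
    \<comment> \<open>The tails lie in the unit interval, so the value is at most 1/3 or at least
      2/3 according to the first digit.\<close>
    have "c 0 = c' 0"
      using Suc.prems ternary_Suc[of c] ternary_Suc[of c'] ternary_bounds[of "\<lambda>n. c (Suc n)"]
        ternary_bounds[of "\<lambda>n. c' (Suc n)"] by (auto split: if_splits)
    then have "ternary (\<lambda>n. c (Suc n)) = ternary (\<lambda>n. c' (Suc n))"
      using Suc.prems ternary_Suc[of c] ternary_Suc[of c'] by simp
    then show ?case by (rule Suc.IH)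
  qed
qed

lemma dist_ternary: "(\<And>i. i < k \<Longrightarrow> c i = c' i) \<Longrightarrow> dist (ternary c) (ternary c') \<le> (1 / 3) ^ k"
proof (induction k arbitrary: c c')
  case 0
  then show ?case using ternary_bounds[of c] ternary_bounds[of c'] by (simp add: dist_real_def)
next
  case (Suc k)
  have "dist (ternary (\<lambda>n. c (Suc n))) (ternary (\<lambda>n. c' (Suc n))) \<le> (1 / 3) ^ k"
    using Suc.prems by (intro Suc.IH) simp
  then show ?case
    using Suc.prems[of 0] ternary_Suc[of c] ternary_Suc[of c'] by (simp add: dist_real_def abs_if split: if_splits)
qed

lemma range_ternary: "range ternary = cantor_ternary"
proof (intro equalityI subsetI)
  fix x assume "x \<in> range ternary"
  then obtain c where "x = ternary c" by blast
  then show "x \<in> cantor_ternary"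
    unfolding cantor_ternary_def ternary_def
    by (intro CollectI exI[of _ "\<lambda>n. if c n then 2 else 0"]) (auto intro!: arg_cong[of _ _ suminf])
next
  fix x assume "x \<in> cantor_ternary"
  then obtain a :: "nat \<Rightarrow> nat" where a: "\<And>n. a n \<in> {0, 2}" "x = (\<Sum>n. real (a n) / 3 ^ Suc n)"
    unfolding cantor_ternary_def by blast
  have "real (a n) = (if a n = 2 then 2 else 0)" for n using a(1)[of n] by auto
  then have "x = ternary (\<lambda>n. a n = 2)" unfolding a(2) ternary_def by simp
  then show "x \<in> range ternary" by blast
qed

text \<open>A continuous injection of a compact space into a metric space is a homeomorphism onto
  its image. This applies to both \<open>F\<close> and \<open>ternary\<close>.\<close>

lemma cantor_set_range:
  fixes F :: "(nat \<Rightarrow> bool) \<Rightarrow> 'b::metric_space"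
  assumes "continuous_on UNIV F" "inj F"
  shows "cantor_set (range F)"
proof -
  have "continuous_on UNIV ternary"
  proof (rule continuous_on_bool_sequences)
    fix e :: real assume "e > 0"
    then obtain k where "(1 / 3) ^ k < e" using real_arch_pow_inv[of e "1 / 3"] by auto
    then have "dist (ternary c) (ternary c') < e" if "\<forall>i<k. c i = c' i" for c c'
      using dist_ternary[of k c c'] that by simp
    then show "\<exists>k. \<forall>c c'. (\<forall>i<k. c i = c' i) \<longrightarrow> dist (ternary c) (ternary c') < e" by blast
  qed
  then have "(UNIV :: (nat \<Rightarrow> bool) set) homeomorphic range ternary"
    by (intro homeomorphic_compact[OF compact_bool_sequences _ refl inj_ternary])
  moreover have "(UNIV :: (nat \<Rightarrow> bool) set) homeomorphic range F"
    by (intro homeomorphic_compact[OF compact_bool_sequences assms(1) refl assms(2)])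
  ultimately show ?thesis
    unfolding cantor_set_def range_ternary by (meson homeomorphic_sym homeomorphic_trans)
qed

section \<open>The scrambled set\<close>

definition initial_word :: "(nat \<Rightarrow> bool) \<Rightarrow> nat \<Rightarrow> bool list" where
  "initial_word c k = map c [0..<k]"

lemma length_initial_word [simp]: "length (initial_word c k) = k"
  by (simp add: initial_word_def)

lemma take_initial_word: "j \<le> k \<Longrightarrow> take j (initial_word c k) = initial_word c j"
  by (simp add: initial_word_def take_map)

lemma initial_word_eq_iff: "initial_word c k = initial_word c' k \<longleftrightarrow> (\<forall>i<k. c i = c' i)"
  by (auto simp: initial_word_def)

text \<open>\<open>d k \<le> \<epsilon> k\<close> makes the jumps of the histories vanish, so their
  limits are genuine orbits; the geometric \<open>\<epsilon>\<close> gives closed forms for error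
  sums.\<close>

locale scrambling_stages = scrambling X f d \<epsilon> y \<phi>
  for X :: "'a::metric_space set" and f d \<epsilon> y \<phi> +
  fixes st :: "nat \<Rightarrow> 'a stage" and \<gamma> :: real
  assumes ok: "stage_ok k (st k)" and step: "stage_step k (st k) (st (Suc k))"
    and d_le: "d k \<le> \<epsilon> k" and eps: "\<epsilon> k = \<gamma> / 2 ^ k" and \<gamma>: "\<gamma> > 0"
begin

lemma eps_Suc: "\<epsilon> k = 2 * \<epsilon> (Suc k)" and eps_pos: "\<epsilon> k > 0"
  using \<gamma> by (simp_all add: eps)

lemma eps_sum: "(\<Sum>j<k. \<epsilon> j) = 2 * \<gamma> - 2 * \<epsilon> k"
proof (induction k)
  case (Suc k)
  then show ?case using eps_Suc[of k] by simp
qed (simp add: eps)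

lemma eps_LIMSEQ: "\<epsilon> \<longlonglongrightarrow> 0"
proof -
  have "(\<lambda>k. \<gamma> * (1 / 2) ^ k) \<longlonglongrightarrow> \<gamma> * 0"
    by (intro tendsto_intros LIMSEQ_power_zero) simp
  then show ?thesis by (simp add: eps[abs_def] power_divide)
qed

section \<open>Limits of the histories and their orbits\<close>

definition approx :: "(nat \<Rightarrow> bool) \<Rightarrow> nat \<Rightarrow> nat \<Rightarrow> 'a" where
  "approx c k i = hist (st k) (initial_word c k) (origin (st k) + i)"

lemma approx_step: "i \<le> horizon (st k) \<Longrightarrow> dist (approx c (Suc k) i) (approx c k i) \<le> \<epsilon> k"
  using step[of k] take_initial_word[of k "Suc k" c] unfolding stage_step_def approx_def
  by (metis length_initial_word le_SucI order_refl)

lemma horizon_mono: "k \<le> m \<Longrightarrow> horizon (st k) \<le> horizon (st m)"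
  using lift_Suc_mono_le[of "\<lambda>k. horizon (st k)"] step by (simp add: stage_step_def)

lemma horizon_ge: "k \<le> horizon (st (Suc k))"
proof -
  obtain p m where "p + m \<le> horizon (st (Suc k))" "k \<le> m"
    using step[of k] unfolding stage_step_def by blast
  then show ?thesis by linarith
qed

text \<open>The bound is the geometric sum of the errors of the steps from \<open>k\<close> to
  \<open>k + j\<close>; \<open>i\<close> stays below all later horizons.\<close>

lemma approx_later:
  assumes "i \<le> horizon (st k)"
  shows "dist (approx c k i) (approx c (k + j) i) \<le> 2 * \<epsilon> k - 2 * \<epsilon> (k + j)"
proof (induction j)
  case (Suc j)
  have "i \<le> horizon (st (k + j))" using assms horizon_mono[of k "k + j"] by simp
  then have "dist (approx c (k + Suc j) i) (approx c (k + j) i) \<le> \<epsilon> (k + j)"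
    using approx_step by simp
  then show ?case
    using Suc eps_Suc[of "k + j"]
      dist_triangle2[of "approx c k i" "approx c (k + Suc j) i" "approx c (k + j) i"] by simp
qed simp

lemma approx_pseudo_orbit: "pseudo_orbit X f (d k) (approx c k)"
  using ok[of k] unfolding stage_ok_def returning_def pseudo_orbit_def approx_def by simp

lemma approx_converges: "\<exists>z\<in>X. (\<lambda>k. approx c k i) \<longlonglongrightarrow> z"
proof -
  have "Cauchy (\<lambda>k. approx c k i)"
  proof (rule metric_CauchyI)
    fix e :: real assume "e > 0"
    then have "\<forall>\<^sub>F k in sequentially. \<epsilon> k < e / 4 \<and> Suc i \<le> k"
      using order_tendstoD(2)[OF eps_LIMSEQ, of "e / 4"]
      by (auto intro: eventually_conj eventually_ge_at_top)
    then obtain k where k: "\<epsilon> k < e / 4" "Suc i \<le> k"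
      using eventually_happens'[OF sequentially_bot] by blast
    have i: "i \<le> horizon (st k)"
      using horizon_ge[of i] horizon_mono[OF k(2)] by linarith
    have near: "dist (approx c k i) (approx c m i) < e / 2" if "m \<ge> k" for m
      using approx_later[OF i, of c "m - k"] eps_pos[of m] k(1) that by simp
    have "dist (approx c m i) (approx c n i) < e" if "m \<ge> k" "n \<ge> k" for m n
      using near[OF that(1)] near[OF that(2)]
        dist_triangle3[of "approx c m i" "approx c n i" "approx c k i"] by linarith
    then show "\<exists>M. \<forall>m\<ge>M. \<forall>n\<ge>M. dist (approx c m i) (approx c n i) < e" by blast
  qed
  moreover have "approx c k i \<in> X" for k
    using approx_pseudo_orbit by (simp add: pseudo_orbit_def)
  ultimately show ?thesis
    using completeE[OF compact_imp_complete[OF compact], of "\<lambda>k. approx c k i"] by blast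
qed

definition trajectory :: "(nat \<Rightarrow> bool) \<Rightarrow> nat \<Rightarrow> 'a" where
  "trajectory c i = (SOME z. z \<in> X \<and> (\<lambda>k. approx c k i) \<longlonglongrightarrow> z)"

lemma trajectory: "trajectory c i \<in> X" "(\<lambda>k. approx c k i) \<longlonglongrightarrow> trajectory c i"
proof -
  have "\<exists>z. z \<in> X \<and> (\<lambda>k. approx c k i) \<longlonglongrightarrow> z" using approx_converges by blast
  from someI_ex[OF this] show "trajectory c i \<in> X" "(\<lambda>k. approx c k i) \<longlonglongrightarrow> trajectory c i"
    unfolding trajectory_def by blast+
qed

definition point :: "(nat \<Rightarrow> bool) \<Rightarrow> 'a" where
  "point c = trajectory c 0"

lemma trajectory_Suc: "trajectory c (Suc i) = f (trajectory c i)"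
proof -
  have "(\<lambda>k. f (approx c k i)) \<longlonglongrightarrow> f (trajectory c i)"
    using continuous_on_tendsto_compose[OF continuous trajectory(2) trajectory(1)]
      approx_pseudo_orbit by (simp add: pseudo_orbit_def)
  then have "(\<lambda>k. dist (f (approx c k i)) (approx c k (Suc i))) \<longlonglongrightarrow>
      dist (f (trajectory c i)) (trajectory c (Suc i))"
    by (intro tendsto_dist trajectory(2))
  moreover have "dist (f (approx c k i)) (approx c k (Suc i)) \<le> \<epsilon> k" for k
    using approx_pseudo_orbit[of k c] d_le[of k] order_trans unfolding pseudo_orbit_def by blast
  ultimately have "dist (f (trajectory c i)) (trajectory c (Suc i)) \<le> 0"
    by (intro LIMSEQ_le[OF _ eps_LIMSEQ]) auto
  then show ?thesis by simp
qed

lemma funpow_point: "(f ^^ i) (point c) = trajectory c i"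
  by (induction i) (simp_all add: point_def trajectory_Suc)

lemma point_in: "point c \<in> X"
  by (simp add: point_def trajectory)

lemma point_tracks:
  assumes "i \<le> horizon (st k)"
  shows "dist ((f ^^ i) (point c)) (approx c k i) \<le> 2 * \<epsilon> k"
proof -
  have "(\<lambda>m. dist (approx c m i) (approx c k i)) \<longlonglongrightarrow> dist (trajectory c i) (approx c k i)"
    by (intro tendsto_intros trajectory(2))
  moreover have "dist (approx c m i) (approx c k i) \<le> 2 * \<epsilon> k" if "m \<ge> k" for m
    using approx_later[OF assms, of c "m - k"] eps_pos[of m] that by (simp add: dist_commute)
  ultimately have "dist (trajectory c i) (approx c k i) \<le> 2 * \<epsilon> k"
    by (intro Lim_bounded) auto
  then show ?thesis by (simp add: funpow_point)
qed

text \<open>The lifts so far cost \<open>2 * \<gamma> - 2 * \<epsilon> (Suc k)\<close> and all later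
  perturbations \<open>2 * \<epsilon> (Suc k)\<close>, so the total does not depend on
  \<open>k\<close>.\<close>

lemma separated_phase:
  "\<exists>p m. k * p \<le> m \<and> k \<le> m \<and>
    (\<forall>c t. t < m \<longrightarrow> dist ((f ^^ (p + t)) (point c)) (y (\<phi> k (initial_word c (Suc k))) t) \<le> 2 * \<gamma>)"
proof -
  obtain p m where pm: "p + m \<le> horizon (st (Suc k))" "k * p \<le> m" "k \<le> m"
    and near: "\<And>c t. length c = Suc k \<Longrightarrow> t < m \<Longrightarrow>
      dist (hist (st (Suc k)) c (origin (st (Suc k)) + (p + t))) (y (\<phi> k c) t) \<le> (\<Sum>j<Suc k. \<epsilon> j)"
    using step[of k] unfolding stage_step_def by blast
  have "dist ((f ^^ (p + t)) (point c)) (y (\<phi> k (initial_word c (Suc k))) t) \<le> 2 * \<gamma>" if "t < m" for c t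
  proof -
    have "dist (approx c (Suc k) (p + t)) (y (\<phi> k (initial_word c (Suc k))) t) \<le> 2 * \<gamma> - 2 * \<epsilon> (Suc k)"
      using near[of "initial_word c (Suc k)" t] that unfolding approx_def eps_sum by simp
    moreover have "dist ((f ^^ (p + t)) (point c)) (approx c (Suc k) (p + t)) \<le> 2 * \<epsilon> (Suc k)"
      using pm(1) that by (intro point_tracks) simp
    ultimately show ?thesis
      using dist_triangle[of "(f ^^ (p + t)) (point c)" "y (\<phi> k (initial_word c (Suc k))) t" "approx c (Suc k) (p + t)"]
      by linarith
  qed
  then show ?thesis using pm by blast
qed

text \<open>The histories differ by at most \<open>2 * \<epsilon> k\<close>, and each of the two
  points is within \<open>2 * \<epsilon> (Suc k) = \<epsilon> k\<close> of its history.\<close>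

lemma proximal_phase:
  "\<exists>p m. k * p \<le> m \<and> k \<le> m \<and>
    (\<forall>c c' t. t < m \<longrightarrow> dist ((f ^^ (p + t)) (point c)) ((f ^^ (p + t)) (point c')) \<le> 4 * \<epsilon> k)"
proof -
  obtain p m where pm: "p + m \<le> horizon (st (Suc k))" "k * p \<le> m" "k \<le> m"
    and near: "\<And>c c' t. length c = Suc k \<Longrightarrow> length c' = Suc k \<Longrightarrow> t < m \<Longrightarrow>
      dist (hist (st (Suc k)) c (origin (st (Suc k)) + (p + t)))
        (hist (st (Suc k)) c' (origin (st (Suc k)) + (p + t))) \<le> 2 * \<epsilon> k"
    using step[of k] unfolding stage_step_def by blast
  have "dist ((f ^^ (p + t)) (point c)) ((f ^^ (p + t)) (point c')) \<le> 4 * \<epsilon> k" if "t < m" for c c' t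
  proof -
    have "dist (approx c (Suc k) (p + t)) (approx c' (Suc k) (p + t)) \<le> 2 * \<epsilon> k"
      using near[of "initial_word c (Suc k)" "initial_word c' (Suc k)" t] that unfolding approx_def by simp
    moreover have "dist ((f ^^ (p + t)) (point b)) (approx b (Suc k) (p + t)) \<le> 2 * \<epsilon> (Suc k)" for b
      using pm(1) that by (intro point_tracks) simp
    ultimately show ?thesis
      using dist_triangle[of "(f ^^ (p + t)) (point c)" "(f ^^ (p + t)) (point c')" "approx c (Suc k) (p + t)"]
        dist_triangle3[of "approx c (Suc k) (p + t)" "(f ^^ (p + t)) (point c')" "approx c' (Suc k) (p + t)"]
        dist_triangle2[of "approx c (Suc k) (p + t)" "(f ^^ (p + t)) (point c')" "approx c' (Suc k) (p + t)"]
        eps_Suc[of k] by (smt (verit))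
  qed
  then show ?thesis using pm by blast
qed

lemma continuous_point: "continuous_on UNIV point"
proof (rule continuous_on_bool_sequences)
  fix e :: real assume "e > 0"
  then obtain k where k: "\<epsilon> k < e / 4"
    using eventually_happens'[OF sequentially_bot order_tendstoD(2)[OF eps_LIMSEQ, of "e / 4"]] by auto
  have "dist (point c) (point c') < e" if "\<forall>i<k. c i = c' i" for c c'
  proof -
    have "approx c k 0 = approx c' k 0"
      using that by (simp add: approx_def flip: initial_word_eq_iff)
    then have "dist (point c) (approx c k 0) \<le> 2 * \<epsilon> k" "dist (point c') (approx c k 0) \<le> 2 * \<epsilon> k"
      using point_tracks[of 0 k c] point_tracks[of 0 k c'] by simp_all
    then show ?thesis
      using dist_triangle2[of "point c" "point c'" "approx c k 0"] k by linarith
  qed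
  then show "\<exists>k. \<forall>c c'. (\<forall>i<k. c i = c' i) \<longrightarrow> dist (point c) (point c') < e" by blast
qed

end

text \<open>Every finite list of pairwise distinct words of equal length is decoded from infinitely many
  \<open>k\<close>, so every tuple of distinct sequences receives the labels \<open>0, 1, 2, \<dots>\<close> infinitely often.\<close>

definition label :: "nat \<Rightarrow> bool list \<Rightarrow> nat" where
  "label k w = (let ws = from_nat (fst (prod_decode k)) in LEAST i. take (length (ws ! i)) w = ws ! i)"

lemma label_initial_word:
  fixes n :: nat
  assumes "inj_on xs {..<n}"
  shows "\<exists>k\<ge>K. \<forall>i<n. label k (initial_word (xs i) (Suc k)) = i"
proof -
  have "\<exists>J. \<forall>i<n. \<forall>j<n. initial_word (xs i) J = initial_word (xs j) J \<longrightarrow> i = j"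
  proof -
    have "\<exists>l. xs i \<noteq> xs j \<longrightarrow> xs i l \<noteq> xs j l" for i j by auto
    then obtain l where l: "\<And>i j. xs i \<noteq> xs j \<Longrightarrow> xs i (l i j) \<noteq> xs j (l i j)" by metis
    \<comment> \<open>The sum dominates all chosen indices of difference at once.\<close>
    define J where "J = Suc (\<Sum>i<n. \<Sum>j<n. l i j)"
    have "i = j" if "i < n" "j < n" "initial_word (xs i) J = initial_word (xs j) J" for i j
    proof (rule ccontr)
      assume "i \<noteq> j"
      then have "xs i (l i j) \<noteq> xs j (l i j)"
        using that(1,2) assms by (intro l) (auto dest: inj_onD)
      moreover have "l i j \<le> (\<Sum>j<n. l i j)" using that(2) by (intro member_le_sum) auto
      moreover have "(\<Sum>j<n. l i j) \<le> (\<Sum>i<n. \<Sum>j<n. l i j)"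
        using that(1) by (intro member_le_sum) auto
      ultimately show False using that(3) unfolding initial_word_eq_iff J_def by (meson le_trans le_imp_less_Suc)
    qed
    then show ?thesis by blast
  qed
  then obtain J where J: "\<And>i j. i < n \<Longrightarrow> j < n \<Longrightarrow> initial_word (xs i) J = initial_word (xs j) J \<Longrightarrow> i = j" by blast
  define ws where "ws = map (\<lambda>i. initial_word (xs i) J) [0..<n]"
  \<comment> \<open>The second component forces \<open>k \<ge> K + J\<close>, so words of length
    \<open>Suc k\<close> contain the prefix of length \<open>J\<close>.\<close>
  define k where "k = prod_encode (to_nat ws, K + J)"
  have k: "K + J \<le> k" unfolding k_def by (rule le_prod_encode_2)
  have "label k (initial_word (xs i) (Suc k)) = i" if "i < n" for i
  proof -
    have ws: "ws ! j = initial_word (xs j) J" if "j < n" for j using that by (simp add: ws_def)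
    have "(LEAST j. take (length (ws ! j)) (initial_word (xs i) (Suc k)) = ws ! j) = i"
    proof (rule Least_equality)
      show "take (length (ws ! i)) (initial_word (xs i) (Suc k)) = ws ! i"
        using ws that k by (simp add: take_initial_word)
      fix j assume j: "take (length (ws ! j)) (initial_word (xs i) (Suc k)) = ws ! j"
      show "i \<le> j"
      \<comment> \<open>Beyond the list \<open>ws ! j\<close> is unspecified, but then
        \<open>j \<ge> n > i\<close>.\<close>
      proof (cases "j < n")
        case True
        then have "initial_word (xs i) J = initial_word (xs j) J"
          using j ws k by (simp add: take_initial_word)
        then show ?thesis using J[OF that True] by simp
      qed (use that in simp)
    qed
    then show ?thesis by (simp add: label_def k_def)
  qed
  moreover have "K \<le> k" using k by simp
  ultimately show ?thesis by blast
qed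

context compact_system
begin

text \<open>Used contrapositively: separation somewhere in a window of length \<open>W\<close>
  forces a distance above \<open>\<delta>\<close> at the start of the window.\<close>

lemma equicontinuous_iterates:
  assumes "\<epsilon> > 0"
  shows "\<exists>\<delta>>0. \<forall>p\<in>X. \<forall>q\<in>X. dist p q \<le> \<delta> \<longrightarrow> (\<forall>l\<le>W. dist ((f ^^ l) p) ((f ^^ l) q) \<le> \<epsilon>)"
proof (induction W)
  case 0
  then show ?case using assms by auto
next
  case (Suc W)
  then obtain \<delta> where \<delta>: "\<delta> > 0"
    "\<And>p q l. p \<in> X \<Longrightarrow> q \<in> X \<Longrightarrow> dist p q \<le> \<delta> \<Longrightarrow> l \<le> W \<Longrightarrow> dist ((f ^^ l) p) ((f ^^ l) q) \<le> \<epsilon>"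
    by blast
  have "uniformly_continuous_on X (f ^^ Suc W)"
    by (rule compact_uniformly_continuous[OF continuous_funpow compact])
  then obtain \<eta> where \<eta>: "\<eta> > 0"
    "\<And>p q. p \<in> X \<Longrightarrow> q \<in> X \<Longrightarrow> dist p q < \<eta> \<Longrightarrow> dist ((f ^^ Suc W) p) ((f ^^ Suc W) q) < \<epsilon>"
    unfolding uniformly_continuous_on_def using assms by metis
  have "dist ((f ^^ l) p) ((f ^^ l) q) \<le> \<epsilon>"
    if "p \<in> X" "q \<in> X" "dist p q \<le> min \<delta> (\<eta> / 2)" "l \<le> Suc W" for p q l
  proof (cases "l = Suc W")
    case True
    then show ?thesis using \<eta>(2)[of p q] \<eta>(1) that by simp
  next
    case False
    then show ?thesis using \<delta>(2)[of p q l] that by simp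
  qed
  then show ?case using \<delta>(1) \<eta>(1) by (intro exI[of _ "min \<delta> (\<eta> / 2)"]) simp
qed

end

section \<open>Choice of the constants and assembly of the scrambled set\<close>

theorem theorem1p2:
  fixes X :: "'a::metric_space set" and f :: "'a \<Rightarrow> 'a"
  assumes "compact X"
    and "continuous_on X f" and "f ` X \<subseteq> X"
    and "shadowing X f"
    and "zero_dimensional X"
    and "htop X f > 0"
  shows "\<exists>S \<delta>. S \<subseteq> X \<and> mycielski S \<and>
           (\<forall>n\<ge>2. \<delta> n > (0::real) \<and> dist_scrambled_set f n (\<delta> n) S)"
proof -
  interpret compact_system X f by unfold_locales (use assms in auto)
  obtain \<sigma> :: real where \<sigma>: "\<sigma> > 0" "entropy_at_scale X f \<sigma> > 0"
    using assms(6) unfolding htop_def less_SUP_iff by auto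
  \<comment> \<open>Two tracking errors of \<open>2 * \<gamma>\<close> make
    \<open>\<sigma> / 4\<close>; together with \<open>\<sigma> / 2\<close> this stays below the
    separation \<open>\<sigma>\<close> of the symbols.\<close>
  define \<gamma> where "\<gamma> = \<sigma> / 16"
  define \<epsilon> where "\<epsilon> k = \<gamma> / 2 ^ k" for k :: nat
  have pos: "\<gamma> > 0" "\<epsilon> k > 0" for k using \<sigma>(1) by (simp_all add: \<gamma>_def \<epsilon>_def)
  have "\<exists>\<delta>>0. \<forall>\<rho>. pseudo_orbit X f \<delta> \<rho> \<longrightarrow> (\<exists>x\<in>X. \<forall>t. dist ((f ^^ t) x) (\<rho> t) \<le> \<epsilon> k)" for k
    using assms(4) pos(2)[of k] unfolding shadowing_def pseudo_orbit_def by blast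
  then obtain D where D: "\<And>k. D k > 0" "\<And>k \<rho>. pseudo_orbit X f (D k) \<rho> \<Longrightarrow>
      \<exists>x\<in>X. \<forall>t. dist ((f ^^ t) x) (\<rho> t) \<le> \<epsilon> k"
    by metis
  define d where "d k = min (D k) (\<epsilon> k)" for k
  have d: "d k > 0" "d k \<le> \<epsilon> k" for k using D(1) pos by (simp_all add: d_def)
  have shadow: "\<exists>x\<in>X. \<forall>t. dist ((f ^^ t) x) (\<rho> t) \<le> \<epsilon> k" if "pseudo_orbit X f (d k) \<rho>" for k \<rho>
    using that by (intro D(2)) (force simp: pseudo_orbit_def d_def)
  obtain u L a b t1 where a: "cycle_at X f (d 0) u L a" and b: "cycle_at X f (d 0) u L b"
    and t1: "t1 < L" "dist (a t1) (b t1) > \<sigma>"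
    using separated_cycles[OF \<sigma>(1) d(1) \<sigma>(2)] by blast
  have "L > 0" using t1 by simp
  define y where "y = alternation L a b"
  interpret scrambling X f d \<epsilon> y label
    by unfold_locales (use d shadow in auto)
  obtain st where "\<And>k. stage_ok k (st k)" "\<And>k. stage_step k (st k) (st (Suc k))"
    using stage_sequence[OF \<open>L > 0\<close> a] returning_alternation[OF \<open>L > 0\<close> a b] y_def by metis
  then interpret scrambling_stages X f d \<epsilon> y label st \<gamma>
    by unfold_locales (use d pos \<epsilon>_def in auto)
  \<comment> \<open>One window for all pairs of labels below \<open>n\<close>. It grows with
    \<open>n\<close>, which is why \<open>\<delta> n\<close> depends on \<open>n\<close>.\<close>
  define W where "W n = L * ((n + 2) * (n + 2)) + (n + 3) * L" for n
  have y_sep: "\<exists>l\<le>W n. dist (y i (t + l)) (y j (t + l)) > \<sigma>" if ij: "i < j" "j < n" for i j n t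
  proof -
    obtain t' where t': "t \<le> t'" "t' \<le> t + (L * ((i + 2) * (j + 2)) + (i + 3) * L)"
      and yt: "y i t' = b t1" "y j t' = a t1"
      using alternation_separated[OF ij(1) t1(1)] unfolding y_def by blast
    have "L * ((i + 2) * (j + 2)) + (i + 3) * L \<le> W n"
      unfolding W_def using ij by (intro add_mono mult_mono) auto
    then show ?thesis
      using t' yt t1(2) by (intro exI[of _ "t' - t"]) (auto simp: dist_commute)
  qed
  have "\<exists>\<delta>>0. \<forall>p\<in>X. \<forall>q\<in>X. dist p q \<le> \<delta> \<longrightarrow> (\<forall>l\<le>W n. dist ((f ^^ l) p) ((f ^^ l) q) \<le> \<sigma> / 2)" for n
    using \<sigma>(1) by (intro equicontinuous_iterates) simp
  then obtain \<delta> where \<delta>: "\<And>n. \<delta> n > 0" "\<And>n p q l. p \<in> X \<Longrightarrow> q \<in> X \<Longrightarrow> dist p q \<le> \<delta> n \<Longrightarrow> l \<le> W n \<Longrightarrow>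
      dist ((f ^^ l) p) ((f ^^ l) q) \<le> \<sigma> / 2"
    by metis
  have distal: "\<exists>p m. K * p \<le> m \<and> K \<le> m \<and> (\<forall>t. t + W n < m \<longrightarrow> (\<forall>i j. i < j \<and> j < n \<longrightarrow>
      dist ((f ^^ (p + t)) (point (cs i))) ((f ^^ (p + t)) (point (cs j))) > \<delta> n))"
    if inj: "inj_on cs {..<n}" for n K cs
  proof -
    \<comment> \<open>At this stage the \<open>i\<close>-th sequence follows
      \<open>y i\<close>.\<close>
    obtain k where k: "K \<le> k" "\<And>i. i < n \<Longrightarrow> label k (initial_word (cs i) (Suc k)) = i"
      using label_initial_word[OF inj] by blast
    obtain p m where pm: "k * p \<le> m" "k \<le> m" and near: "\<And>c t. t < m \<Longrightarrow>
        dist ((f ^^ (p + t)) (point c)) (y (label k (initial_word c (Suc k))) t) \<le> 2 * \<gamma>"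
      using separated_phase by blast
    have "dist ((f ^^ (p + t)) (point (cs i))) ((f ^^ (p + t)) (point (cs j))) > \<delta> n"
      if t: "t + W n < m" and ij: "i < j" "j < n" for t i j
    proof (rule ccontr)
      let ?g = "\<lambda>l i. (f ^^ (p + (t + l))) (point (cs i))"
      \<comment> \<open>Closeness at time \<open>p + t\<close> would persist over the whole window,
        in which \<open>y i\<close> and \<open>y j\<close> separate.\<close>
      assume "\<not> ?thesis"
      then have close: "dist (?g l i) (?g l j) \<le> \<sigma> / 2" if "l \<le> W n" for l
        using \<delta>(2)[OF funpow_in[OF point_in] funpow_in[OF point_in] _ that, of "p + t" "cs i" "p + t" "cs j"]
        by (simp add: funpow_add_apply[symmetric] ac_simps)
      obtain l where l: "l \<le> W n" "dist (y i (t + l)) (y j (t + l)) > \<sigma>"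
        using y_sep[OF ij] by blast
      have "dist (?g l i) (y i (t + l)) \<le> 2 * \<gamma>" "dist (?g l j) (y j (t + l)) \<le> 2 * \<gamma>"
        using near[of "t + l" "cs i"] near[of "t + l" "cs j"] k(2) ij t l(1) by auto
      then show False
        using l(2) close[OF l(1)] \<sigma>(1) dist_triangle3[of "y i (t + l)" "y j (t + l)" "?g l i"]
          dist_triangle[of "?g l i" "y j (t + l)" "?g l j"] unfolding \<gamma>_def by linarith
    qed
    moreover have "K * p \<le> m" "K \<le> m"
      using pm k(1) by (meson mult_le_mono1 order_trans)+
    ultimately show ?thesis by blast
  qed
  \<comment> \<open>Injectivity follows from the distal phase for pairs; length
    \<open>Suc (W 2)\<close> makes \<open>t = 0\<close> an admissible time.\<close>
  have inj: "inj point"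
  proof (rule injI, rule ccontr)
    fix c c' :: "nat \<Rightarrow> bool" assume eq: "point c = point c'" and "c \<noteq> c'"
    then have "inj_on (\<lambda>i::nat. if i = 0 then c else c') {..<2}"
      by (auto simp: inj_on_def)
    note distal[OF this, of "Suc (W 2)"]
    then obtain p m where "Suc (W 2) \<le> m" and
      far: "\<And>t (i :: nat) j. t + W 2 < m \<Longrightarrow> i < j \<and> j < 2 \<Longrightarrow> \<delta> 2 < dist
        ((f ^^ (p + t)) (point (if i = 0 then c else c'))) ((f ^^ (p + t)) (point (if j = 0 then c else c')))"
      by blast
    then have "\<delta> 2 < dist ((f ^^ p) (point c)) ((f ^^ p) (point c'))"
      using far[of 0 0 1] by simp
    then show False using eq \<delta>(1)[of 2] by simp
  qed
  have "dist_scrambled_set f n (\<delta> n) (range point)" for n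
    unfolding dist_scrambled_set_def
  proof (intro allI impI)
    fix xs assume xs: "(\<forall>i<n. xs i \<in> range point) \<and> inj_on xs {..<n}"
    then have "\<forall>i<n. \<exists>c. xs i = point c" by blast
    then obtain cs where cs: "\<And>i. i < n \<Longrightarrow> xs i = point (cs i)" by metis
    have "inj_on cs {..<n}"
      using xs cs unfolding inj_on_def by (metis lessThan_iff)
    note distal = distal[OF this]
    show "dist_scrambled_tuple f n (\<delta> n) xs"
      unfolding dist_scrambled_tuple_def
    proof (intro conjI allI impI)
      fix e :: real assume "e > 0"
      show "upper_density_one (\<lambda>k. \<forall>i j. i < j \<and> j < n \<longrightarrow> dist ((f ^^ k) (xs i)) ((f ^^ k) (xs j)) < e)"
      proof (rule upper_density_oneI[where W = 0])
        fix K
        have "\<forall>\<^sub>F k in sequentially. \<epsilon> k < e / 4 \<and> K \<le> k"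
          using order_tendstoD(2)[OF eps_LIMSEQ, of "e / 4"] \<open>e > 0\<close>
          by (auto intro: eventually_conj eventually_ge_at_top)
        then obtain k where k: "\<epsilon> k < e / 4" "K \<le> k"
          using eventually_happens'[OF sequentially_bot] by blast
        obtain p m where pm: "k * p \<le> m" "k \<le> m" and near: "\<And>c c' t. t < m \<Longrightarrow>
            dist ((f ^^ (p + t)) (point c)) ((f ^^ (p + t)) (point c')) \<le> 4 * \<epsilon> k"
          using proximal_phase by blast
        have "dist ((f ^^ (p + t)) (xs i)) ((f ^^ (p + t)) (xs j)) < e" if "t < m" "i < j" "j < n" for t i j
          using near[OF that(1), of "cs i" "cs j"] cs[of i] cs[of j] that k(1) by simp
        moreover have "K * p \<le> m" "K \<le> m"
          using pm k(2) by (meson mult_le_mono1 order_trans)+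
        ultimately show "\<exists>p m. K * p \<le> m \<and> K \<le> m \<and> (\<forall>t. t + 0 < m \<longrightarrow> (\<forall>i j. i < j \<and> j < n \<longrightarrow>
            dist ((f ^^ (p + t)) (xs i)) ((f ^^ (p + t)) (xs j)) < e))"
          unfolding add_0_right by blast
      qed
    next
      show "upper_density_one (\<lambda>k. \<forall>i j. i < j \<and> j < n \<longrightarrow> \<delta> n < dist ((f ^^ k) (xs i)) ((f ^^ k) (xs j)))"
      proof (rule upper_density_oneI[where W = "W n"])
        fix K
        obtain p m where pm: "K * p \<le> m" "K \<le> m" and far: "\<And>t i j. t + W n < m \<Longrightarrow> i < j \<Longrightarrow> j < n \<Longrightarrow>
            dist ((f ^^ (p + t)) (point (cs i))) ((f ^^ (p + t)) (point (cs j))) > \<delta> n"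
          using distal[of K] by blast
        have "\<delta> n < dist ((f ^^ (p + t)) (xs i)) ((f ^^ (p + t)) (xs j))"
          if "t + W n < m" "i < j" "j < n" for t i j
          using far[OF that] cs[of i] cs[of j] that by simp
        then show "\<exists>p m. K * p \<le> m \<and> K \<le> m \<and> (\<forall>t. t + W n < m \<longrightarrow> (\<forall>i j. i < j \<and> j < n \<longrightarrow>
            \<delta> n < dist ((f ^^ (p + t)) (xs i)) ((f ^^ (p + t)) (xs j))))"
          using pm by blast
      qed
    qed
  qed
  \<comment> \<open>A single Cantor set, taken as a constant sequence of Cantor sets.\<close>
  moreover have "mycielski (range point)"
    unfolding mycielski_def using cantor_set_range[OF continuous_point inj]
    by (intro exI[of _ "\<lambda>_. range point"]) simp
  moreover have "range point \<subseteq> X" using point_in by blast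
  ultimately show ?thesis using \<delta>(1) by blast
qed

end
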